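(* Let $a\ge0$ and let $(q,r)$ be $a$-admissible. There is $C(a,r)>0$ such that for every $F\in\mathbb S^+$, $$\Big\|\int_{\mathbb R}S_a(t-\tau)\big(F(\cdot,\tau)\big)\,d\tau\Big\|_{L^q_tL^r_a}\le C(a,r)\|F\|_{L^{q'}_tL^{r'}_a}.$$
   Context: $\mathbb R^+=(0,\infty)$, $d\omega_a(x)=x^a\,dx$, $L^r_a=L^r(\mathbb R^+,d\omega_a)$, $\|u\|_{L^q_tL^r_a}=(\int_{\mathbb R}\|u(\cdot,t)\|_{L^r_a}^q\,dt)^{1/q}$; primes denote conjugate exponents. A pair $(q,r)$ is $a$-admissible if $r>2$, additionally $r<\frac{2(a+1)}{a-1}$ when $a>1$, and $\frac2q=(a+1)(\frac12-\frac1r)$. $\mathbb S^+$ is the set of $F\in C^\infty(\mathbb R^+\times\mathbb R;\mathbb C)$ with $\sup_{k+\ell\le p}\sup_{(x,t)}(1+x^2+t^2)^{p/2}|(x^{-1}\partial_x)^k\partial_t^\ell F(x,t)|<\infty$ for every $p\in\mathbb N_0$. Kernel: for $x,y>0$, $S_a(x,y,t)=\frac{e^{-i(a+1)\pi/4}}{(2|t|)^{(a+1)/2}}\big(\frac{xy}{2|t|}\big)^{\frac{1-a}2}J_{\frac{a-1}2}\big(\frac{xy}{2|t|}\big)e^{i\frac{x^2+y^2}{4|t|}}$ if $t>0$, its analogue with $e^{i(a+1)\pi/4}$ and $e^{-i\frac{x^2+y^2}{4|t|}}$ if $t<0$ ($J_\nu$ Bessel function of the first kind); $S_a(t)\varphi(x)=\int_0^\infty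 S_a(x,y,t)\varphi(y)\,d\omega_a(y)$, $S_a(0)=\mathrm{Id}$. *)

theory Defs
  imports "HOL-Analysis.Analysis"
begin

section \<open>Bessel function of the first kind (series definition), real order nu > -1, z > 0\<close>

definition besselJ :: "real \<Rightarrow> real \<Rightarrow> real" where
  "besselJ nu z = (\<Sum>k. (-1) ^ k / (fact k * Gamma (real k + nu + 1)) * (z / 2) powr (2 * real k + nu))"

definition Skernel :: "real \<Rightarrow> real \<Rightarrow> real \<Rightarrow> real \<Rightarrow> complex" where
  "Skernel a x y t =
     (let z = x * y / (2 * \<bar>t\<bar>);
          amp = complex_of_real (z powr ((1 - a) / 2) * besselJ ((a - 1) / 2) z / (2 * \<bar>t\<bar>) powr ((a + 1) / 2))
      in if t > 0 then exp (- \<i> * of_real ((a + 1) * pi / 4)) * amp * exp (\<i> * of_real ((x\<^sup>2 + y\<^sup>2) / (4 * \<bar>t\<bar>)))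
         else exp (\<i> * of_real ((a + 1) * pi / 4)) * amp * exp (- \<i> * of_real ((x\<^sup>2 + y\<^sup>2) / (4 * \<bar>t\<bar>))))"

definition Sop :: "real \<Rightarrow> real \<Rightarrow> (real \<Rightarrow> complex) \<Rightarrow> real \<Rightarrow> complex" where
  "Sop a t phi x = (if t = 0 then phi x
     else (LINT y:{0<..}|lborel. Skernel a x y t * phi y * complex_of_real (y powr a)))"

definition duhamel :: "real \<Rightarrow> (real \<Rightarrow> real \<Rightarrow> complex) \<Rightarrow> real \<Rightarrow> real \<Rightarrow> complex" where
  "duhamel a F x t = (LINT tau|lborel. Sop a (t - tau) (\<lambda>y. F y tau) x)"

definition ennpow :: "ennreal \<Rightarrow> real \<Rightarrow> ennreal" where
  "ennpow v p = (if v = \<infinity> then \<infinity> else ennreal (enn2real v powr p))"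

definition Lr_a_norm :: "real \<Rightarrow> real \<Rightarrow> (real \<Rightarrow> complex) \<Rightarrow> ennreal" where
  "Lr_a_norm a r f = ennpow (\<integral>\<^sup>+ x\<in>{0<..}. ennreal (cmod (f x) powr r * x powr a) \<partial>lborel) (1 / r)"

definition mixed_norm :: "real \<Rightarrow> real \<Rightarrow> real \<Rightarrow> (real \<Rightarrow> real \<Rightarrow> complex) \<Rightarrow> ennreal" where
  "mixed_norm a q r u = ennpow (\<integral>\<^sup>+ t. ennpow (Lr_a_norm a r (\<lambda>x. u x t)) q \<partial>lborel) (1 / q)"

definition conj_exp :: "real \<Rightarrow> real" where
  "conj_exp p = p / (p - 1)"

definition admissible :: "real \<Rightarrow> real \<Rightarrow> real \<Rightarrow> bool" where
  "admissible a q r \<longleftrightarrow> r > 2 \<and> (a > 1 \<longrightarrow> r < 2 * (a + 1) / (a - 1))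
      \<and> 2 / q = (a + 1) * (1 / 2 - 1 / r)"

definition pderx :: "(real \<Rightarrow> real \<Rightarrow> complex) \<Rightarrow> real \<Rightarrow> real \<Rightarrow> complex" where
  "pderx G x t = vector_derivative (\<lambda>s. G s t) (at x)"

definition pdert :: "(real \<Rightarrow> real \<Rightarrow> complex) \<Rightarrow> real \<Rightarrow> real \<Rightarrow> complex" where
  "pdert G x t = vector_derivative (\<lambda>s. G x s) (at t)"

fun dpart :: "bool list \<Rightarrow> (real \<Rightarrow> real \<Rightarrow> complex) \<Rightarrow> real \<Rightarrow> real \<Rightarrow> complex" where
  "dpart [] G = G"
| "dpart (b # w) G = (if b then pderx else pdert) (dpart w G)"

definition smooth_pos :: "(real \<Rightarrow> real \<Rightarrow> complex) \<Rightarrow> bool" where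
  "smooth_pos F \<longleftrightarrow> (\<forall>w. (\<forall>x>0. \<forall>t.
        (\<lambda>s. dpart w F s t) differentiable (at x) \<and> (\<lambda>s. dpart w F x s) differentiable (at t))
      \<and> continuous_on ({0<..} \<times> UNIV) (\<lambda>(x, t). dpart w F x t))"

definition Lx :: "(real \<Rightarrow> real \<Rightarrow> complex) \<Rightarrow> real \<Rightarrow> real \<Rightarrow> complex" where
  "Lx G x t = pderx G x t / complex_of_real x"

definition Splus :: "(real \<Rightarrow> real \<Rightarrow> complex) set" where
  "Splus = {F. smooth_pos F \<and> (\<forall>p::nat. \<exists>M. \<forall>k l. k + l \<le> p \<longrightarrow> (\<forall>x>0. \<forall>t.
      (1 + x\<^sup>2 + t\<^sup>2) powr (real p / 2) * cmod ((Lx ^^ k) ((pdert ^^ l) F) x t) \<le> M))}"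

end

theory Submission
  imports Defs
begin

text \<open>
  Up to unimodular chirps and a dilation, the propagator is the Hankel transform whose kernel is the
  normalised Bessel function \<open>z\<^bsup>-\<nu>\<^esup> J\<^sub>\<nu>(z)\<close>, \<open>\<nu> = (a - 1) / 2\<close>. An energy argument for the Bessel
  equation bounds this function by its value at 0, which gives the \<open>L\<^sup>1 \<rightarrow> L\<^sup>\<infinity>\<close> estimate with constant
  of order \<open>\<bar>t\<bar>\<^bsup>-(a+1)/2\<^esup>\<close>. The Hankel transform maps Gaussians to Gaussians and is isometric on
  their span, which is dense, so it contracts \<open>L\<^sup>2\<close>. Real interpolation yields the decay
  \<open>\<bar>t\<bar>\<^bsup>-2/q\<^esup>\<close> from \<open>L\<^bsup>r'\<^esup>\<close> to \<open>L\<^bsup>r\<^esup>\<close>. By Minkowski's inequality the Duhamel integral is then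
  dominated by a fractional integral in time, and since \<open>2 < q\<close> the Hardy-Littlewood-Sobolev
  inequality on the line applies.
\<close>

section \<open>Real powers of extended nonnegative numbers\<close>

text \<open>The exponents are tied together by scaling. The r-th root of the interpolated decay is
  |t|^(-(a+1)(1/2-1/r)), which admissibility identifies with |t|^(-2/q). This kernel just misses
  L^(q/2), the space that Young's convolution inequality would require, so the kernel has to be cut
  at a distance that depends on the level. The bound 2/q < 1, which makes it locally integrable, is
  the upper limit on r when a > 1 and automatic when a <= 1. Cutting a function at a height tied to
  the level gives strong type bounds directly, without complex interpolation; the price is a factor
  4r/(r-2), finite because r > 2. In L^2 only a contraction is wanted, so no inversion formula
  enters: equality on sums of Gaussians and Fatou's lemma in the limit suffice. Integrals of
  nonnegative functions take values in [0, \<infinity>], which admits an infinite right-hand side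
  and a Duhamel integral whose convergence is not presupposed.\<close>

lemma ennpow_top [simp]: "ennpow top p = top"
  by (simp add: ennpow_def)

lemma ennpow_ennreal: "0 \<le> x \<Longrightarrow> ennpow (ennreal x) p = ennreal (x powr p)"
  by (simp add: ennpow_def)

lemma ennpow_0 [simp]: "ennpow 0 p = 0"
  by (simp add: ennpow_def)

lemma ennpow_1 [simp]: "ennpow v 1 = v"
  by (cases v) (auto simp: ennpow_ennreal)

text \<open>Every power fixes both 0 and \<open>top\<close>, since \<open>0 powr p = 0\<close> and
  \<open>ennpow\<close> keeps \<open>top\<close> even for p <= 0; hence powers compose for arbitrary
  real exponents.\<close>

lemma ennpow_ennpow: "ennpow (ennpow v p) q = ennpow v (p * q)"
  by (cases v) (auto simp: ennpow_ennreal powr_powr)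

lemma ennpow_mono: "0 \<le> p \<Longrightarrow> u \<le> v \<Longrightarrow> ennpow u p \<le> ennpow v p"
  by (cases u; cases v) (auto simp: ennpow_ennreal top_unique intro: powr_mono2)

lemma ennpow_cmult:
  assumes "0 < c" shows "ennpow (ennreal c * v) p = ennreal (c powr p) * ennpow v p"
proof (cases v)
  case (real x)
  then show ?thesis using assms
    by (simp add: ennpow_ennreal powr_mult flip: ennreal_mult)
next
  case top
  then show ?thesis using assms by (simp add: ennreal_mult_top)
qed

lemma ennpow_measurable [measurable]:
  assumes [measurable]: "f \<in> borel_measurable M"
  shows "(\<lambda>x. ennpow (f x) p) \<in> borel_measurable M"
proof -
  have "(\<lambda>x. ennreal (enn2real (f x) powr p)) \<in> borel_measurable M"
    by (intro measurable_compose[OF _ measurable_ennreal] powr_real_measurable) auto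
  moreover have "f -` {top} \<inter> space M \<in> sets M" by simp
  then have "{x \<in> space M. f x = top} \<in> sets M" by (simp add: vimage_def Int_def conj_commute)
  ultimately show ?thesis unfolding ennpow_def infinity_ennreal_def
    by (intro measurable_If) auto
qed

text \<open>Merges two finite constants through an identity between reals while the third factor may
  be infinite.\<close>

lemma ennreal_mult_assoc_eq:
  "0 \<le> a \<Longrightarrow> 0 \<le> b \<Longrightarrow> a * b = c \<Longrightarrow> ennreal a * (ennreal b * X) = ennreal c * X"
  by (auto simp: ennreal_mult mult.assoc)

section \<open>Layer-cake formula and Markov's inequality\<close>

lemma nn_integral_powr_from_0:
  fixes e c :: real
  assumes "- 1 < e" "0 \<le> c"
  shows "(\<integral>\<^sup>+s. ennreal (s powr e) * indicator {0..c} s \<partial>lborel) = ennreal (c powr (e + 1) / (e + 1))"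
proof -
  have "((\<lambda>x. x powr e) has_integral (c powr (e + 1) / (e + 1))) {0..c}"
    using has_integral_powr_from_0[OF assms] .
  from nn_integral_has_integral_lebesgue[OF _ this] show ?thesis
    by (simp add: ennreal_indicator ennreal_mult' mult.commute)
qed

lemma layer_cake_ennpow:
  assumes "0 < r"
  shows "ennpow v r = (\<integral>\<^sup>+s. ennreal (r * s powr (r - 1)) * indicator {s. 0 < s \<and> ennreal s < v} s \<partial>lborel)"
proof -
  have fin: "ennreal (x powr r) = (\<integral>\<^sup>+s. ennreal (r * s powr (r - 1)) * indicator {0<..<x} s \<partial>lborel)"
    if "0 \<le> x" for x
  proof -
    have "(\<integral>\<^sup>+s. ennreal (r * s powr (r - 1)) * indicator {0<..<x} s \<partial>lborel)
        = (\<integral>\<^sup>+s. ennreal r * (ennreal (s powr (r - 1)) * indicator {0..x} s) \<partial>lborel)"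
    proof (rule nn_integral_cong_AE)
      show "AE s in lborel. ennreal (r * s powr (r - 1)) * indicator {0<..<x} s
         = ennreal r * (ennreal (s powr (r - 1)) * indicator {0..x} s)"
        using AE_lborel_singleton[of x] AE_lborel_singleton[of 0]
        by eventually_elim (use assms in \<open>auto simp: indicator_def ennreal_mult\<close>)
    qed
    also have "\<dots> = ennreal r * ennreal (x powr r / r)"
      using nn_integral_powr_from_0[of "r - 1" x] assms that
      by (subst nn_integral_cmult) auto
    also have "\<dots> = ennreal (x powr r)"
      using assms by (simp flip: ennreal_mult)
    finally show ?thesis ..
  qed
  show ?thesis
  proof (cases v)
    case (real x)
    then have *: "{s. 0 < s \<and> ennreal s < v} = {0<..<x}"
      by (auto simp: ennreal_less_iff)
    show ?thesis unfolding * using fin[OF real(1)] real by (simp add: ennpow_ennreal)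
  next
    case top
    \<comment> \<open>For an infinite value the right-hand integral exceeds
      \<open>real n powr r\<close> for every n, hence every real number.\<close>
    have *: "ennreal (real n powr r) \<le> (\<integral>\<^sup>+s. ennreal (r * s powr (r - 1)) * indicator {s. 0 < s \<and> ennreal s < v} s \<partial>lborel)" for n
      unfolding fin[OF of_nat_0_le_iff]
      by (rule nn_integral_mono) (auto simp: indicator_def top)
    have "ennreal y < (\<integral>\<^sup>+s. ennreal (r * s powr (r - 1)) * indicator {s. 0 < s \<and> ennreal s < v} s \<partial>lborel)"
      if "0 \<le> y" for y
    proof -
      obtain n where n: "y powr (1 / r) < real n" using reals_Archimedean2 by blast
      have "y = (y powr (1 / r)) powr r" using assms that by (simp add: powr_powr)
      also have "\<dots> < real n powr r" using n assms by (intro powr_less_mono2) auto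
      finally have "ennreal y < ennreal (real n powr r)" using that by (simp add: ennreal_less_iff)
      then show ?thesis using * less_le_trans by blast
    qed
    then show ?thesis unfolding top ennpow_top
      by (cases "\<integral>\<^sup>+s. ennreal (r * s powr (r - 1)) * indicator {s. 0 < s \<and> ennreal s < top} s \<partial>lborel"
          rule: ennreal_cases) (use top in force)+
  qed
qed

text \<open>Tonelli applied to the pointwise formula. It turns every later norm estimate into an
  estimate of level sets, where the cut may depend on the level s.\<close>

lemma nn_integral_ennpow_layer_cake:
  assumes "sigma_finite_measure M" and [measurable]: "f \<in> borel_measurable M" and "0 < r"
  shows "(\<integral>\<^sup>+x. ennpow (f x) r \<partial>M) =
    (\<integral>\<^sup>+s. ennreal (r * s powr (r - 1)) * indicator {0<..} s * emeasure M {x\<in>space M. ennreal s < f x} \<partial>lborel)"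
proof -
  interpret sigma_finite_measure M by fact
  interpret pair_sigma_finite M lborel ..
  have "(\<integral>\<^sup>+x. ennpow (f x) r \<partial>M) = (\<integral>\<^sup>+x. \<integral>\<^sup>+s. ennreal (r * s powr (r - 1)) * (indicator {0<..} s *
      indicator {p\<in>space (M \<Otimes>\<^sub>M lborel). ennreal (snd p) < f (fst p)} (x, s)) \<partial>lborel \<partial>M)"
    unfolding layer_cake_ennpow[OF assms(3)]
    by (intro nn_integral_cong) (auto simp: indicator_def space_pair_measure)
  also have "\<dots> = (\<integral>\<^sup>+s. \<integral>\<^sup>+x. ennreal (r * s powr (r - 1)) * (indicator {0<..} s *
      indicator {p\<in>space (M \<Otimes>\<^sub>M lborel). ennreal (snd p) < f (fst p)} (x, s)) \<partial>M \<partial>lborel)"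
    by (subst Fubini') measurable
  also have "\<dots> = (\<integral>\<^sup>+s. \<integral>\<^sup>+x. (ennreal (r * s powr (r - 1)) * indicator {0<..} s) *
      indicator {x\<in>space M. ennreal s < f x} x \<partial>M \<partial>lborel)"
    by (intro nn_integral_cong) (auto simp: indicator_def space_pair_measure)
  also have "\<dots> = (\<integral>\<^sup>+s. ennreal (r * s powr (r - 1)) * indicator {0<..} s * emeasure M {x\<in>space M. ennreal s < f x} \<partial>lborel)"
    by (intro nn_integral_cong) (simp add: nn_integral_cmult)
  finally show ?thesis .
qed

text \<open>The set S is decoupled from the level set of u: in the applications S is a level set of
  one function and u is only the part of it that must still be large there.\<close>

lemma emeasure_le_nn_integral_Markov:
  assumes [measurable]: "u \<in> borel_measurable M" "S \<in> sets M" and "0 < c"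
    and "\<And>x. x \<in> S \<Longrightarrow> ennreal c \<le> u x"
  shows "emeasure M S \<le> ennreal (1 / c) * (\<integral>\<^sup>+x. u x \<partial>M)"
proof -
  have "emeasure M S = (\<integral>\<^sup>+x. indicator S x \<partial>M)" by simp
  also have "\<dots> \<le> (\<integral>\<^sup>+x. ennreal (1 / c) * u x \<partial>M)"
  proof (rule nn_integral_mono)
    fix x
    have "1 \<le> ennreal (1 / c) * u x" if "x \<in> S"
      using mult_left_mono[OF assms(4)[OF that], of "ennreal (1 / c)"] assms(3)
      by (simp flip: ennreal_mult)
    then show "indicator S x \<le> ennreal (1 / c) * u x" by (auto simp: indicator_def)
  qed
  also have "\<dots> = ennreal (1 / c) * (\<integral>\<^sup>+x. u x \<partial>M)"
    by (rule nn_integral_cmult) simp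
  finally show ?thesis .
qed

section \<open>Minkowski's integral inequality\<close>

text \<open>Duality is avoided by writing H = (H/w) w and applying Jensen with the weight w:
  (\<integral>H)^r <= (\<integral>w)^(r-1) \<integral>H^r w^(1-r). Integrating in x, Tonelli and
  \<open>Hw\<close> reduce the last double integral to \<integral>w. Any measurable majorant w of
  the slice norms may be used, so a decay estimate can be inserted directly.\<close>

lemma nn_integral_ennpow_Minkowski:
  assumes "sigma_finite_measure M" "sigma_finite_measure N" and r: "1 < r"
    and [measurable]: "(\<lambda>(x, y). H x y) \<in> borel_measurable (M \<Otimes>\<^sub>M N)" "w \<in> borel_measurable N"
    and H0: "\<And>x y. (0::real) \<le> H x y" and w0: "\<And>y. (0::real) \<le> w y"
    and Hw: "AE y in N. (\<integral>\<^sup>+x. ennreal (H x y powr r) \<partial>M) \<le> ennreal (w y powr r)"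
  shows "(\<integral>\<^sup>+x. ennpow (\<integral>\<^sup>+y. ennreal (H x y) \<partial>N) r \<partial>M) \<le> ennpow (\<integral>\<^sup>+y. ennreal (w y) \<partial>N) r"
proof -
  interpret M: sigma_finite_measure M by fact
  interpret N: sigma_finite_measure N by fact
  interpret pair_sigma_finite M N ..
  define r' where "r' = r / (r - 1)"
  have r': "r' > 1" "1 / r + 1 / r' = 1" using r by (auto simp: r'_def field_simps)
  define A where "A x = (\<integral>\<^sup>+y. ennreal (H x y powr r * w y powr (1 - r)) \<partial>N)" for x
  define W where "W = (\<integral>\<^sup>+y. ennreal (w y) \<partial>N)"
  have [measurable]: "A \<in> borel_measurable M" unfolding A_def by measurable
  \<comment> \<open>Where w vanishes, \<open>w y powr (1 - r)\<close> is 0 and the integrand of A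
    loses all information on H. The hypothesis forces H = 0 there for almost every x; the two
    quantifiers are exchanged so that the fact is available at fixed x.\<close>
  have null: "AE x in M. AE y in N. w y = 0 \<longrightarrow> H x y = 0"
  proof -
    have "AE y in N. AE x in M. w y = 0 \<longrightarrow> H x y = 0"
      using Hw AE_space
    proof eventually_elim
      case (elim y)
      show ?case
      proof (cases "w y = 0")
        case True
        with elim have "(\<integral>\<^sup>+x. ennreal (H x y powr r) \<partial>M) = 0" by simp
        then have "AE x in M. ennreal (H x y powr r) = 0"
          using elim(2) by (subst (asm) nn_integral_0_iff_AE) auto
        then show ?thesis by eventually_elim (use H0 in \<open>auto simp: ennreal_eq_0_iff\<close>)
      qed simp
    qed
    then show ?thesis by (subst AE_commute) measurable
  qed
  show ?thesis
  proof (cases "W = top")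
    case True
    then show ?thesis by (simp add: W_def)
  next
    case W: False
    define V where "V = enn2real W"
    have WV: "W = ennreal V" "V \<ge> 0" using W by (auto simp: V_def less_top)
    \<comment> \<open>Jensen's inequality for the measure with density \<open>w\<close>\<close>
    have jensen: "ennpow (\<integral>\<^sup>+y. ennreal (H x y) \<partial>N) r \<le> ennreal (V powr (r - 1)) * A x"
      if x: "x \<in> space M" and ae: "AE y in N. w y = 0 \<longrightarrow> H x y = 0" for x
    proof -
      have [measurable]: "H x \<in> borel_measurable N" using x by measurable
      consider "V = 0" | "A x = 0" | "V > 0" "A x = top" | B where "V > 0" "A x = ennreal B" "B > 0"
        using WV by (cases "A x") (auto simp: less_le)
      then show ?thesis
      proof cases
        case 1
        then have "AE y in N. w y = 0" using WV w0
          by (simp add: W_def nn_integral_0_iff_AE ennreal_eq_0_iff)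
             (auto elim!: eventually_mono simp: antisym)
        with ae have "AE y in N. ennreal (H x y) = 0" by eventually_elim auto
        then have "(\<integral>\<^sup>+y. ennreal (H x y) \<partial>N) = 0" by (subst nn_integral_0_iff_AE) auto
        then show ?thesis by simp
      next
        case 2
        then have "AE y in N. ennreal (H x y powr r * w y powr (1 - r)) = 0" 
          unfolding A_def by (subst (asm) nn_integral_0_iff_AE) auto
        with ae have "AE y in N. ennreal (H x y) = 0"
          by eventually_elim (use H0 w0 in \<open>auto simp: ennreal_eq_0_iff mult_le_0_iff not_le\<close>)
        then have "(\<integral>\<^sup>+y. ennreal (H x y) \<partial>N) = 0" by (subst nn_integral_0_iff_AE) auto
        then show ?thesis by simp
      next
        case 3
        then show ?thesis by (simp add: ennreal_mult_top)
      next
        case 4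
        \<comment> \<open>The minimiser of the Young bound over all scalings: both terms become
          multiples of \<theta> V, with weights 1/r and 1/r', and the sum \<theta> V is the Hoelder
          bound.\<close>
        define \<theta> where "\<theta> = (B / V) powr (1 / r)"
        have \<theta>: "\<theta> > 0" using 4 by (simp add: \<theta>_def)
        have "(\<integral>\<^sup>+y. ennreal (H x y) \<partial>N) \<le>
           (\<integral>\<^sup>+y. ennreal (\<theta> powr (1 - r) / r) * ennreal (H x y powr r * w y powr (1 - r)) + ennreal (\<theta> / r') * ennreal (w y) \<partial>N)"
        proof (rule nn_integral_mono_AE, use ae in eventually_elim)
          fix y assume y: "w y = 0 \<longrightarrow> H x y = 0"
          have "H x y \<le> \<theta> powr (1 - r) / r * (H x y powr r * w y powr (1 - r)) + \<theta> / r' * w y"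
          proof (cases "w y = 0")
            case False
            then have w: "w y > 0" using w0[of y] by simp
            have "(H x y / (w y * \<theta>) powr (1 / r')) * (w y * \<theta>) powr (1 / r') \<le>
              (H x y / (w y * \<theta>) powr (1 / r')) powr r / r + ((w y * \<theta>) powr (1 / r')) powr r' / r'"
              by (rule Youngs_inequality) (use r r' H0 w \<theta> in auto)
            also have "((w y * \<theta>) powr (1 / r')) powr r' = w y * \<theta>"
              using r' w \<theta> by (simp add: powr_powr)
            also have "(H x y / (w y * \<theta>) powr (1 / r')) powr r = H x y powr r * (w y * \<theta>) powr (1 - r)"
            proof -
              have "r / r' = r - 1" using r by (simp add: r'_def)
              then show ?thesis using r w \<theta> H0 
                by (simp add: powr_divide powr_powr) (simp add: powr_diff divide_simps)
            qed
            finally show ?thesis using w \<theta> by (simp add: powr_mult algebra_simps)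
          qed (use y w0 \<theta> r' in auto)
          then show "ennreal (H x y) \<le> ennreal (\<theta> powr (1 - r) / r) * ennreal (H x y powr r * w y powr (1 - r)) + ennreal (\<theta> / r') * ennreal (w y)"
            using r r' \<theta> w0 by (simp flip: ennreal_mult ennreal_plus add: ennreal_leI)
        qed
        also have "\<dots> = ennreal (\<theta> powr (1 - r) / r) * A x + ennreal (\<theta> / r') * W"
          unfolding A_def W_def by (subst nn_integral_add) (auto simp: nn_integral_cmult)
        also have "\<dots> = ennreal (\<theta> powr (1 - r) / r * B + \<theta> / r' * V)"
          using 4 r r' \<theta> WV by (simp flip: ennreal_mult ennreal_plus)
        also have "\<theta> powr (1 - r) / r * B + \<theta> / r' * V = \<theta> * V"
        proof -
          have "\<theta> powr (1 - r) = \<theta> * \<theta> powr (- r)" using \<theta> by (simp add: powr_diff powr_minus divide_simps)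
          also have "\<theta> powr (- r) = V / B" using 4 r by (simp add: \<theta>_def powr_powr powr_minus)
          finally have "\<theta> powr (1 - r) / r * B = \<theta> * V * (1 / r)" using 4 by simp
          then have "\<theta> powr (1 - r) / r * B + \<theta> / r' * V = \<theta> * V * (1 / r + 1 / r')" by (simp add: algebra_simps)
          then show ?thesis using r' by simp
        qed
        finally have "ennpow (\<integral>\<^sup>+y. ennreal (H x y) \<partial>N) r \<le> ennpow (ennreal (\<theta> * V)) r"
          using r by (intro ennpow_mono) auto
        also have "\<dots> = ennreal ((\<theta> * V) powr r)" using \<theta> 4 by (simp add: ennpow_ennreal)
        also have "(\<theta> * V) powr r = V powr (r - 1) * B"
          using \<theta> 4 r by (simp add: powr_mult \<theta>_def powr_powr powr_diff divide_simps)
        finally show ?thesis using 4 by (simp add: ennreal_mult)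
      qed
    qed
    have "(\<integral>\<^sup>+x. ennpow (\<integral>\<^sup>+y. ennreal (H x y) \<partial>N) r \<partial>M) \<le> (\<integral>\<^sup>+x. ennreal (V powr (r - 1)) * A x \<partial>M)"
      by (rule nn_integral_mono_AE) (use null AE_space in \<open>eventually_elim, auto intro!: jensen\<close>)
    also have "\<dots> = ennreal (V powr (r - 1)) * (\<integral>\<^sup>+x. A x \<partial>M)"
      by (rule nn_integral_cmult) measurable
    finally have 1: "(\<integral>\<^sup>+x. ennpow (\<integral>\<^sup>+y. ennreal (H x y) \<partial>N) r \<partial>M) \<le> ennreal (V powr (r - 1)) * (\<integral>\<^sup>+x. A x \<partial>M)" .
    have "(\<integral>\<^sup>+x. A x \<partial>M) = (\<integral>\<^sup>+y. \<integral>\<^sup>+x. ennreal (H x y powr r * w y powr (1 - r)) \<partial>M \<partial>N)"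
      unfolding A_def by (rule Fubini'[symmetric]) measurable
    also have "\<dots> \<le> W" unfolding W_def
    proof (rule nn_integral_mono_AE, use Hw AE_space in eventually_elim)
      fix y assume y: "(\<integral>\<^sup>+x. ennreal (H x y powr r) \<partial>M) \<le> ennreal (w y powr r)" "y \<in> space N"
      have [measurable]: "(\<lambda>x. H x y) \<in> borel_measurable M" using y(2) by measurable
      have "(\<integral>\<^sup>+x. ennreal (H x y powr r * w y powr (1 - r)) \<partial>M) = (\<integral>\<^sup>+x. ennreal (H x y powr r) \<partial>M) * ennreal (w y powr (1 - r))"
        by (simp add: nn_integral_multc ennreal_mult)
      also have "\<dots> \<le> ennreal (w y powr r) * ennreal (w y powr (1 - r))"
        by (intro mult_right_mono y) simp
      also have "\<dots> = ennreal (w y)"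
        using w0[of y] by (simp flip: ennreal_mult powr_add)
      finally show "(\<integral>\<^sup>+x. ennreal (H x y powr r * w y powr (1 - r)) \<partial>M) \<le> ennreal (w y)" .
    qed
    finally have "(\<integral>\<^sup>+x. A x \<partial>M) \<le> W" .
    then have "ennreal (V powr (r - 1)) * (\<integral>\<^sup>+x. A x \<partial>M) \<le> ennreal (V powr (r - 1)) * W"
      by (rule mult_left_mono) simp
    note order_trans[OF 1 this]
    also have "\<dots> = ennpow W r"
      unfolding WV(1) using WV(2) 
      by (auto simp: ennpow_ennreal powr_diff simp flip: ennreal_mult)
    finally show ?thesis unfolding W_def .
  qed
qed

section \<open>Fractional integration on the line and interpolation\<close>

lemma nn_integral_abs_powr_near_0:
  fixes R \<alpha> :: real
  assumes "\<alpha> < 1" "0 \<le> R"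
  shows "(\<integral>\<^sup>+s. ennreal (\<bar>s\<bar> powr (- \<alpha>)) * indicator {-R..R} s \<partial>lborel) \<le> ennreal (2 * R powr (1 - \<alpha>) / (1 - \<alpha>))"
proof -
  let ?f = "\<lambda>s. ennreal (s powr (- \<alpha>)) * indicator {0..R} s"
  have I: "(\<integral>\<^sup>+s. ?f s \<partial>lborel) = ennreal (R powr (1 - \<alpha>) / (1 - \<alpha>))"
    using nn_integral_powr_from_0[of "- \<alpha>" R] assms by (simp add: add.commute)
  have I': "(\<integral>\<^sup>+s. ?f (- s) \<partial>lborel) = (\<integral>\<^sup>+s. ?f s \<partial>lborel)"
    using nn_integral_real_affine[of ?f "-1" 0] by simp
  have "(\<integral>\<^sup>+s. ennreal (\<bar>s\<bar> powr (- \<alpha>)) * indicator {-R..R} s \<partial>lborel) \<le> (\<integral>\<^sup>+s. ?f s + ?f (- s) \<partial>lborel)"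
    by (intro nn_integral_mono) (auto simp: indicator_def abs_if)
  also have "\<dots> = (\<integral>\<^sup>+s. ?f s \<partial>lborel) + (\<integral>\<^sup>+s. ?f (- s) \<partial>lborel)"
    by (rule nn_integral_add) measurable
  also have "\<dots> = ennreal (2 * R powr (1 - \<alpha>) / (1 - \<alpha>))"
    unfolding I' I using assms by (simp flip: ennreal_plus)
  finally show ?thesis .
qed

text \<open>The exponent 2 is (2/q) q, the q-th power of the fractional kernel, for every q. The
  case R = 1 also bounds the tails of the test functions.\<close>

lemma nn_integral_abs_powr_tail:
  fixes R :: real
  assumes "0 < R"
  shows "(\<integral>\<^sup>+s. ennreal (\<bar>s\<bar> powr (- 2)) * indicator {s. R < \<bar>s\<bar>} s \<partial>lborel) \<le> ennreal (2 / R)"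
proof -
  let ?f = "\<lambda>s. ennreal (s powr (- 2)) * indicator {R..} s"
  have "((\<lambda>x. x powr (- 2)) has_integral 1 / R) {R..}"
    using has_integral_powr_to_inf[of "- 2" R] assms by (simp add: powr_minus divide_inverse)
  from nn_integral_has_integral_lebesgue[OF _ this]
  have I: "(\<integral>\<^sup>+s. ?f s \<partial>lborel) = ennreal (1 / R)"
    by (simp add: ennreal_indicator ennreal_mult' mult.commute)
  have I': "(\<integral>\<^sup>+s. ?f (- s) \<partial>lborel) = (\<integral>\<^sup>+s. ?f s \<partial>lborel)"
    using nn_integral_real_affine[of ?f "-1" 0] by simp
  have "(\<integral>\<^sup>+s. ennreal (\<bar>s\<bar> powr (- 2)) * indicator {s. R < \<bar>s\<bar>} s \<partial>lborel) \<le> (\<integral>\<^sup>+s. ?f s + ?f (- s) \<partial>lborel)"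
    by (intro nn_integral_mono) (auto simp: indicator_def abs_if)
  also have "\<dots> = (\<integral>\<^sup>+s. ?f s \<partial>lborel) + (\<integral>\<^sup>+s. ?f (- s) \<partial>lborel)"
    by (rule nn_integral_add) measurable
  also have "\<dots> = ennreal (2 / R)"
    unfolding I' I using assms by (simp flip: ennreal_plus)
  finally show ?thesis .
qed

lemma nn_integral_translate:
  fixes f :: "real \<Rightarrow> ennreal"
  assumes "f \<in> borel_measurable borel"
  shows "(\<integral>\<^sup>+s. f (t - s) \<partial>lborel) = (\<integral>\<^sup>+s. f s \<partial>lborel)" "(\<integral>\<^sup>+s. f (s - t) \<partial>lborel) = (\<integral>\<^sup>+s. f s \<partial>lborel)"
  using nn_integral_real_affine[OF assms, of "-1" t] nn_integral_real_affine[OF assms, of 1 "-t"] by simp_all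

text \<open>
  Beyond distance \<open>R\<close> the potential is at most \<open>s / 2\<close> by Young's inequality, and the part of
  \<open>g\<close> below the height \<open>s / (4 b)\<close> contributes at most \<open>s / 4\<close> within distance \<open>R\<close>,
  where \<open>b\<close> bounds the mass of the truncated kernel. Only the high part near the diagonal
  remains, and the \<open>L\<^sup>1\<close> Chebyshev inequality suffices for it.
\<close>
lemma HLS_level_set:
  fixes q n s :: real and g :: "real \<Rightarrow> real"
  assumes q: "2 < q" and [measurable]: "g \<in> borel_measurable borel" and g0: "\<And>\<tau>. 0 \<le> g \<tau>"
    and n: "(\<integral>\<^sup>+\<tau>. ennreal (g \<tau> powr (q / (q - 1))) \<partial>lborel) = ennreal n" "0 < n" and s: "0 < s"
  defines "R \<equiv> 8 * (4 * n) powr (q - 1) * s powr (- q)"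
  defines "b \<equiv> 2 / (1 - 2 / q) * R powr (1 - 2 / q)"
  shows "emeasure lborel {t. ennreal s < (\<integral>\<^sup>+\<tau>. ennreal (\<bar>t - \<tau>\<bar> powr (- 2 / q)) * ennreal (g \<tau>) \<partial>lborel)}
    \<le> ennreal (4 * b / s) * (\<integral>\<^sup>+\<tau>. ennreal (g \<tau>) * indicator {\<tau>. s / (4 * b) < g \<tau>} \<tau> \<partial>lborel)"
proof -
  define p where "p = q / (q - 1)"
  have p: "1 < p" "1 / q + 1 / p = 1" using q by (auto simp: p_def field_simps)
  define \<alpha> where "\<alpha> = 2 / q"
  have \<alpha>: "\<alpha> < 1" "\<alpha> * q = 2" using q by (auto simp: \<alpha>_def)
  have R: "R > 0" using n s by (simp add: R_def)
  have b: "b > 0" using R \<alpha> by (simp add: b_def flip: \<alpha>_def)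
  \<comment> \<open>The scaling that balances Young's inequality at distance beyond R: \<theta>^p =
    4n/s makes the g-term s/4, and R = 8 \<theta>^q / s makes the kernel term \<theta>^q (2/R) also
    s/4.\<close>
  define \<theta> where "\<theta> = (4 * n / s) powr (1 / p)"
  have \<theta>: "\<theta> > 0" using n s by (simp add: \<theta>_def)
  have \<theta>p: "\<theta> powr p = 4 * n / s" using n s p by (simp add: \<theta>_def powr_powr)
  have \<theta>q: "\<theta> powr q * 8 = R * s"
  proof -
    have "1 / p * q = q - 1" using q by (simp add: p_def)
    then have "\<theta> powr q = (4 * n / s) powr (q - 1)" by (simp add: \<theta>_def powr_powr)
    also have "\<dots> = (4 * n) powr (q - 1) * s powr (- q) * s"
      using n s by (simp add: powr_divide powr_diff powr_minus divide_simps)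
    finally show ?thesis by (simp add: R_def)
  qed
  define \<mu> where "\<mu> = s / (4 * b)"
  have \<mu>: "\<mu> > 0" using b s by (simp add: \<mu>_def)
  define K where "K \<sigma> = ennreal (\<bar>\<sigma>\<bar> powr (- \<alpha>))" for \<sigma> :: real
  have K[measurable]: "K \<in> borel_measurable borel" unfolding K_def by measurable
  define near where "near t = (\<integral>\<^sup>+\<tau>. K (t - \<tau>) * indicator {-R..R} (t - \<tau>) * (ennreal (g \<tau>) * indicator {\<tau>. \<mu> < g \<tau>} \<tau>) \<partial>lborel)" for t
  have [measurable]: "near \<in> borel_measurable borel" unfolding near_def by measurable
  have nearint: "(\<integral>\<^sup>+\<sigma>. K \<sigma> * indicator {-R..R} \<sigma> \<partial>lborel) \<le> ennreal b"
    using nn_integral_abs_powr_near_0[OF \<alpha>(1) less_imp_le[OF R]] by (simp add: K_def b_def \<alpha>_def)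
  have far: "(\<integral>\<^sup>+\<tau>. K (t - \<tau>) * indicator {\<sigma>. R < \<bar>\<sigma>\<bar>} (t - \<tau>) * ennreal (g \<tau>) \<partial>lborel) \<le> ennreal (s / 2)" for t
  proof -
    have "(\<integral>\<^sup>+\<tau>. K (t - \<tau>) * indicator {\<sigma>. R < \<bar>\<sigma>\<bar>} (t - \<tau>) * ennreal (g \<tau>) \<partial>lborel) \<le>
      (\<integral>\<^sup>+\<tau>. ennreal (\<theta> powr q) * (ennreal (\<bar>t - \<tau>\<bar> powr (- 2)) * indicator {\<sigma>. R < \<bar>\<sigma>\<bar>} (t - \<tau>))
         + ennreal (1 / \<theta> powr p) * ennreal (g \<tau> powr p) \<partial>lborel)"
    proof (rule nn_integral_mono)
      fix \<tau>
      have "(\<theta> * \<bar>t - \<tau>\<bar> powr (- \<alpha>)) * (g \<tau> / \<theta>) \<le>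
          (\<theta> * \<bar>t - \<tau>\<bar> powr (- \<alpha>)) powr q / q + (g \<tau> / \<theta>) powr p / p"
        by (rule Youngs_inequality) (use q p g0 \<theta> in auto)
      \<comment> \<open>The factors 1/q and 1/p of Young's inequality are given up in exchange for
        simpler constants.\<close>
      also have "\<dots> \<le> (\<theta> * \<bar>t - \<tau>\<bar> powr (- \<alpha>)) powr q / 1 + (g \<tau> / \<theta>) powr p / 1"
        by (intro add_mono divide_left_mono) (use q p in auto)
      also have "(\<theta> * \<bar>t - \<tau>\<bar> powr (- \<alpha>)) powr q = \<theta> powr q * \<bar>t - \<tau>\<bar> powr (- 2)"
        using \<theta> \<alpha> by (simp add: powr_mult powr_powr)
      also have "(g \<tau> / \<theta>) powr p = g \<tau> powr p / \<theta> powr p"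
        using \<theta> g0 by (simp add: powr_divide)
      finally have *: "\<bar>t - \<tau>\<bar> powr (- \<alpha>) * g \<tau> \<le> \<theta> powr q * \<bar>t - \<tau>\<bar> powr (- 2) + (1 / \<theta> powr p) * g \<tau> powr p"
        using \<theta> by simp
      have "ennreal (\<bar>t - \<tau>\<bar> powr (- \<alpha>)) * ennreal (g \<tau>) \<le> ennreal (\<theta> powr q) * ennreal (\<bar>t - \<tau>\<bar> powr (- 2)) + ennreal (1 / \<theta> powr p) * ennreal (g \<tau> powr p)"
        using * g0 \<theta> by (simp flip: ennreal_mult ennreal_plus add: ennreal_leI)
      then show "K (t - \<tau>) * indicator {\<sigma>. R < \<bar>\<sigma>\<bar>} (t - \<tau>) * ennreal (g \<tau>) \<le>
        ennreal (\<theta> powr q) * (ennreal (\<bar>t - \<tau>\<bar> powr (- 2)) * indicator {\<sigma>. R < \<bar>\<sigma>\<bar>} (t - \<tau>))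
         + ennreal (1 / \<theta> powr p) * ennreal (g \<tau> powr p)"
        by (auto simp: K_def indicator_def)
    qed
    also have "\<dots> = ennreal (\<theta> powr q) * (\<integral>\<^sup>+\<tau>. ennreal (\<bar>t - \<tau>\<bar> powr (- 2)) * indicator {\<sigma>. R < \<bar>\<sigma>\<bar>} (t - \<tau>) \<partial>lborel)
       + ennreal (1 / \<theta> powr p) * ennreal n"
      unfolding n(1)[folded p_def, symmetric]
      by (subst nn_integral_add) (auto simp: nn_integral_cmult)
    also have "(\<integral>\<^sup>+\<tau>. ennreal (\<bar>t - \<tau>\<bar> powr (- 2)) * indicator {\<sigma>. R < \<bar>\<sigma>\<bar>} (t - \<tau>) \<partial>lborel)
        = (\<integral>\<^sup>+s. ennreal (\<bar>s\<bar> powr (- 2)) * indicator {s. R < \<bar>s\<bar>} s \<partial>lborel)"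
      by (rule nn_integral_translate(1)[of "\<lambda>s. ennreal (\<bar>s\<bar> powr (- 2)) * indicator {s. R < \<bar>s\<bar>} s"]) measurable
    also have "ennreal (\<theta> powr q) * \<dots> + ennreal (1 / \<theta> powr p) * ennreal n \<le>
        ennreal (\<theta> powr q) * ennreal (2 / R) + ennreal (1 / \<theta> powr p) * ennreal n"
      by (intro add_mono mult_left_mono nn_integral_abs_powr_tail R) auto
    also have "\<dots> = ennreal (\<theta> powr q * (2 / R) + 1 / \<theta> powr p * n)"
      using n R by (simp flip: ennreal_mult ennreal_plus)
    also have "\<theta> powr q * (2 / R) + 1 / \<theta> powr p * n = s / 2"
      using \<theta>q R n s unfolding \<theta>p by (simp add: field_simps)
    finally show ?thesis .
  qed
  have low: "(\<integral>\<^sup>+\<tau>. K (t - \<tau>) * indicator {-R..R} (t - \<tau>) * ennreal \<mu> \<partial>lborel) \<le> ennreal (s / 4)" for t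
  proof -
    have "(\<integral>\<^sup>+\<tau>. K (t - \<tau>) * indicator {-R..R} (t - \<tau>) * ennreal \<mu> \<partial>lborel) = (\<integral>\<^sup>+\<sigma>. K \<sigma> * indicator {-R..R} \<sigma> \<partial>lborel) * ennreal \<mu>"
      by (subst nn_integral_multc) (auto simp: nn_integral_translate(1)[of "\<lambda>\<sigma>. K \<sigma> * indicator {-R..R} \<sigma>"])
    also have "\<dots> \<le> ennreal b * ennreal \<mu>" by (intro mult_right_mono nearint) simp
    also have "\<dots> = ennreal (s / 4)" using b by (simp add: \<mu>_def flip: ennreal_mult')
    finally show ?thesis .
  qed
  have split: "(\<integral>\<^sup>+\<tau>. K (t - \<tau>) * ennreal (g \<tau>) \<partial>lborel) \<le> ennreal (s / 2) + ennreal (s / 4) + near t" for t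
  proof -
    have "(\<integral>\<^sup>+\<tau>. K (t - \<tau>) * ennreal (g \<tau>) \<partial>lborel) \<le>
      (\<integral>\<^sup>+\<tau>. (K (t - \<tau>) * indicator {\<sigma>. R < \<bar>\<sigma>\<bar>} (t - \<tau>) * ennreal (g \<tau>)
        + K (t - \<tau>) * indicator {-R..R} (t - \<tau>) * ennreal \<mu>) 
        + K (t - \<tau>) * indicator {-R..R} (t - \<tau>) * (ennreal (g \<tau>) * indicator {\<tau>. \<mu> < g \<tau>} \<tau>) \<partial>lborel)"
    proof (rule nn_integral_mono)
      fix \<tau>
      consider "R < \<bar>t - \<tau>\<bar>" | "\<bar>t - \<tau>\<bar> \<le> R" "g \<tau> \<le> \<mu>" | "\<bar>t - \<tau>\<bar> \<le> R" "\<mu> < g \<tau>" by linarith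
      then show "K (t - \<tau>) * ennreal (g \<tau>) \<le> (K (t - \<tau>) * indicator {\<sigma>. R < \<bar>\<sigma>\<bar>} (t - \<tau>) * ennreal (g \<tau>)
        + K (t - \<tau>) * indicator {-R..R} (t - \<tau>) * ennreal \<mu>) 
        + K (t - \<tau>) * indicator {-R..R} (t - \<tau>) * (ennreal (g \<tau>) * indicator {\<tau>. \<mu> < g \<tau>} \<tau>)"
      proof cases
        case 2
        then have "t - \<tau> \<in> {-R..R}" by auto
        with 2 show ?thesis by (auto intro!: mult_left_mono ennreal_leI)
      next
        case 3
        then have "t - \<tau> \<in> {-R..R}" by auto
        with 3 show ?thesis by auto
      qed auto
    qed
    also have "\<dots> = (\<integral>\<^sup>+\<tau>. K (t - \<tau>) * indicator {\<sigma>. R < \<bar>\<sigma>\<bar>} (t - \<tau>) * ennreal (g \<tau>) \<partial>lborel)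
        + (\<integral>\<^sup>+\<tau>. K (t - \<tau>) * indicator {-R..R} (t - \<tau>) * ennreal \<mu> \<partial>lborel) + near t"
      unfolding near_def by (subst nn_integral_add, measurable, subst nn_integral_add) measurable
    also have "\<dots> \<le> ennreal (s / 2) + ennreal (s / 4) + near t"
      by (intro add_mono far low order_refl)
    finally show ?thesis .
  qed
  have "emeasure lborel {t. ennreal s < (\<integral>\<^sup>+\<tau>. K (t - \<tau>) * ennreal (g \<tau>) \<partial>lborel)}
    \<le> ennreal (1 / (s / 4)) * (\<integral>\<^sup>+t. near t \<partial>lborel)"
  proof (rule emeasure_le_nn_integral_Markov)
    show "{t. ennreal s < (\<integral>\<^sup>+\<tau>. K (t - \<tau>) * ennreal (g \<tau>) \<partial>lborel)} \<in> sets lborel" by measurable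
    fix t assume "t \<in> {t. ennreal s < (\<integral>\<^sup>+\<tau>. K (t - \<tau>) * ennreal (g \<tau>) \<partial>lborel)}"
    then have "ennreal s < ennreal (s / 2) + ennreal (s / 4) + near t" using split[of t] by auto
    then show "ennreal (s / 4) \<le> near t"
      using s by (cases "near t") (auto simp: ennreal_less_iff simp flip: ennreal_plus)
  qed (use s in auto)
  also have "(\<integral>\<^sup>+t. near t \<partial>lborel) = (\<integral>\<^sup>+\<tau>. \<integral>\<^sup>+t. K (t - \<tau>) * indicator {-R..R} (t - \<tau>) * (ennreal (g \<tau>) * indicator {\<tau>. \<mu> < g \<tau>} \<tau>) \<partial>lborel \<partial>lborel)"
    unfolding near_def by (rule lborel_pair.Fubini') measurable
  also have "\<dots> = (\<integral>\<^sup>+\<tau>. (\<integral>\<^sup>+\<sigma>. K \<sigma> * indicator {-R..R} \<sigma> \<partial>lborel) * (ennreal (g \<tau>) * indicator {\<tau>. \<mu> < g \<tau>} \<tau>) \<partial>lborel)"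
    by (subst nn_integral_multc) (auto simp: nn_integral_translate(2)[of "\<lambda>\<sigma>. K \<sigma> * indicator {-R..R} \<sigma>"])
  also have "\<dots> = (\<integral>\<^sup>+\<sigma>. K \<sigma> * indicator {-R..R} \<sigma> \<partial>lborel) * (\<integral>\<^sup>+\<tau>. ennreal (g \<tau>) * indicator {\<tau>. \<mu> < g \<tau>} \<tau> \<partial>lborel)"
    by (rule nn_integral_cmult) measurable
  also have "ennreal (1 / (s / 4)) * \<dots> \<le> ennreal (1 / (s / 4)) * (ennreal b * (\<integral>\<^sup>+\<tau>. ennreal (g \<tau>) * indicator {\<tau>. \<mu> < g \<tau>} \<tau> \<partial>lborel))"
    by (intro mult_left_mono mult_right_mono nearint) auto
  also have "\<dots> = ennreal (4 * b / s) * (\<integral>\<^sup>+\<tau>. ennreal (g \<tau>) * indicator {\<tau>. \<mu> < g \<tau>} \<tau> \<partial>lborel)"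
    using b s by (simp flip: mult.assoc ennreal_mult) 
  finally show ?thesis by (simp add: K_def \<alpha>_def \<mu>_def)
qed

text \<open>In the level set bound, b is a multiple of s^(2-q), so the layer-cake weight s^(q-1)
  cancels completely and only the condition s^(q-1) < 4 B g(\<tau>) retains s. Exchanging the
  integrals leaves g times the length (4 B g)^(1/(q-1)), a multiple of g^p because 1/(q-1) = p-1.
  The truncated integral of g in the level set bound is what yields the strong type at once, with no
  interpolation between weak types.\<close>

lemma Hardy_Littlewood_Sobolev_line:
  fixes q :: real
  assumes q: "2 < q"
  obtains C where "0 < C" and
    "\<And>g :: real \<Rightarrow> real. g \<in> borel_measurable borel \<Longrightarrow> (\<And>\<tau>. 0 \<le> g \<tau>) \<Longrightarrow>
      (\<integral>\<^sup>+t. ennpow (\<integral>\<^sup>+\<tau>. ennreal (\<bar>t - \<tau>\<bar> powr (- 2 / q)) * ennreal (g \<tau>) \<partial>lborel) q \<partial>lborel)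
        \<le> ennreal C * ennpow (\<integral>\<^sup>+\<tau>. ennreal (g \<tau> powr (q / (q - 1))) \<partial>lborel) (q - 1)"
proof -
  define p where "p = q / (q - 1)"
  have p: "1 < p" using q by (simp add: p_def)
  \<comment> \<open>The part of 4 B that is independent of g: below, 4 B = c
    n^((q-1)(1-2/q)).\<close>
  define c where "c = 8 / (1 - 2 / q) * (8 * 4 powr (q - 1)) powr (1 - 2 / q)"
  have c: "0 < c" using q by (simp add: c_def)
  have "0 < q * c powr p" using q c by simp
  moreover have "(\<integral>\<^sup>+t. ennpow (\<integral>\<^sup>+\<tau>. ennreal (\<bar>t - \<tau>\<bar> powr (- 2 / q)) * ennreal (g \<tau>) \<partial>lborel) q \<partial>lborel)
        \<le> ennreal (q * c powr p) * ennpow (\<integral>\<^sup>+\<tau>. ennreal (g \<tau> powr p) \<partial>lborel) (q - 1)"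
    if [measurable]: "g \<in> borel_measurable borel" and g0: "\<And>\<tau>. 0 \<le> g \<tau>" for g :: "real \<Rightarrow> real"
  proof -
    let ?f = "\<lambda>t. \<integral>\<^sup>+\<tau>. ennreal (\<bar>t - \<tau>\<bar> powr (- 2 / q)) * ennreal (g \<tau>) \<partial>lborel"
    define N where "N = (\<integral>\<^sup>+\<tau>. ennreal (g \<tau> powr p) \<partial>lborel)"
    consider "N = top" | "N = 0" | n where "N = ennreal n" "0 < n"
      by (cases N) (auto simp: less_le)
    then show ?thesis
    proof cases
      case 1
      then show ?thesis using q c by (simp add: N_def[symmetric] ennreal_mult_top)
    next
      case 2
      then have "AE \<tau> in lborel. ennreal (g \<tau> powr p) = 0"
        unfolding N_def by (subst (asm) nn_integral_0_iff_AE) auto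
      then have "AE \<tau> in lborel. g \<tau> = 0"
        by eventually_elim (auto simp: ennreal_eq_0_iff)
      then have "?f t = 0" for t
        by (subst nn_integral_0_iff_AE) (auto elim: eventually_mono)
      then show ?thesis by simp
    next
      case 3
      define B where "B = 2 / (1 - 2 / q) * (8 * (4 * n) powr (q - 1)) powr (1 - 2 / q)"
      have B: "0 < B" using q 3 by (simp add: B_def)
      \<comment> \<open>The number b of the level set bound as a function of the level: the exponent
        is -q (1 - 2/q) = 2 - q.\<close>
      have b: "2 / (1 - 2 / q) * (8 * (4 * n) powr (q - 1) * s powr (- q)) powr (1 - 2 / q) = B * s powr (2 - q)"
        if "0 < s" for s
      proof -
        have "- q * (1 - 2 / q) = 2 - q" using q by (simp add: field_simps)
        then show ?thesis using that 3 by (simp add: powr_mult powr_powr B_def)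
      qed
      have "(\<integral>\<^sup>+t. ennpow (?f t) q \<partial>lborel) =
        (\<integral>\<^sup>+s. ennreal (q * s powr (q - 1)) * indicator {0<..} s * emeasure lborel {t\<in>space lborel. ennreal s < ?f t} \<partial>lborel)"
        by (rule nn_integral_ennpow_layer_cake) (use q in \<open>auto intro: sigma_finite_lborel\<close>)
      also have "\<dots> \<le> (\<integral>\<^sup>+s. ennreal (4 * q * B) * (\<integral>\<^sup>+\<tau>. ennreal (g \<tau>) * indicator {p. 0 < fst p \<and> fst p powr (q - 1) / (4 * B) < g (snd p)} (s, \<tau>) \<partial>lborel) \<partial>lborel)"
      proof (rule nn_integral_mono)
        fix s :: real
        show "ennreal (q * s powr (q - 1)) * indicator {0<..} s * emeasure lborel {t\<in>space lborel. ennreal s < ?f t}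
          \<le> ennreal (4 * q * B) * (\<integral>\<^sup>+\<tau>. ennreal (g \<tau>) * indicator {p. 0 < fst p \<and> fst p powr (q - 1) / (4 * B) < g (snd p)} (s, \<tau>) \<partial>lborel)"
        proof (cases "0 < s")
          case s: True
          have e1: "q * s powr (q - 1) * (4 * (B * s powr (2 - q)) / s) = 4 * q * B"
            using s by (simp add: powr_diff power2_eq_square field_simps)
          have e2: "s / (4 * (B * s powr (2 - q))) = s powr (q - 1) / (4 * B)"
            using s B by (simp add: powr_diff power2_eq_square field_simps)
          have "ennreal (q * s powr (q - 1)) * emeasure lborel {t. ennreal s < ?f t} \<le>
            ennreal (q * s powr (q - 1)) * (ennreal (4 * (B * s powr (2 - q)) / s) *
              (\<integral>\<^sup>+\<tau>. ennreal (g \<tau>) * indicator {\<tau>. s / (4 * (B * s powr (2 - q))) < g \<tau>} \<tau> \<partial>lborel))"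
            using HLS_level_set[OF q that 3(1)[unfolded N_def p_def] 3(2) s, unfolded b[OF s]]
            by (intro mult_left_mono) auto
          also have "\<dots> = ennreal (4 * q * B) * (\<integral>\<^sup>+\<tau>. ennreal (g \<tau>) * indicator {\<tau>. s powr (q - 1) / (4 * B) < g \<tau>} \<tau> \<partial>lborel)"
            unfolding e2 by (rule ennreal_mult_assoc_eq[OF _ _ e1]) (use q B s in auto)
          finally show ?thesis using s by (simp add: indicator_def)
        qed simp
      qed
      also have "\<dots> = ennreal (4 * q * B) * (\<integral>\<^sup>+s. (\<integral>\<^sup>+\<tau>. ennreal (g \<tau>) * indicator {p. 0 < fst p \<and> fst p powr (q - 1) / (4 * B) < g (snd p)} (s, \<tau>) \<partial>lborel) \<partial>lborel)"
        by (rule nn_integral_cmult) measurable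
      also have "(\<integral>\<^sup>+s. (\<integral>\<^sup>+\<tau>. ennreal (g \<tau>) * indicator {p. 0 < fst p \<and> fst p powr (q - 1) / (4 * B) < g (snd p)} (s, \<tau>) \<partial>lborel) \<partial>lborel)
         = (\<integral>\<^sup>+\<tau>. (\<integral>\<^sup>+s. ennreal (g \<tau>) * indicator {p. 0 < fst p \<and> fst p powr (q - 1) / (4 * B) < g (snd p)} (s, \<tau>) \<partial>lborel) \<partial>lborel)"
        by (rule lborel_pair.Fubini') measurable
      also have "\<dots> \<le> (\<integral>\<^sup>+\<tau>. ennreal ((4 * B) powr (p - 1)) * ennreal (g \<tau> powr p) \<partial>lborel)"
      proof (rule nn_integral_mono)
        fix \<tau>
        have pq: "p - 1 = 1 / (q - 1)" using q by (simp add: p_def field_simps)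
        have "s \<le> (4 * B * g \<tau>) powr (p - 1)" if "0 < s" "s powr (q - 1) / (4 * B) < g \<tau>" for s
        proof -
          have "s = (s powr (q - 1)) powr (p - 1)" using that q unfolding pq by (simp add: powr_powr)
          also have "\<dots> \<le> (4 * B * g \<tau>) powr (p - 1)"
            using that p B by (intro powr_mono2) (auto simp: field_simps)
          finally show ?thesis .
        qed
        then have "(\<integral>\<^sup>+s. ennreal (g \<tau>) * indicator {p. 0 < fst p \<and> fst p powr (q - 1) / (4 * B) < g (snd p)} (s, \<tau>) \<partial>lborel)
          \<le> (\<integral>\<^sup>+s. ennreal (g \<tau>) * indicator {0..(4 * B * g \<tau>) powr (p - 1)} s \<partial>lborel)"
          by (intro nn_integral_mono) (auto simp: indicator_def)
        also have "\<dots> = ennreal (g \<tau>) * ennreal ((4 * B * g \<tau>) powr (p - 1))"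
          by (simp add: nn_integral_cmult)
        also have "\<dots> = ennreal ((4 * B) powr (p - 1)) * ennreal (g \<tau> powr p)"
          using g0[of \<tau>] B by (cases "g \<tau> = 0") (auto simp: powr_mult powr_diff simp flip: ennreal_mult)
        finally show "(\<integral>\<^sup>+s. ennreal (g \<tau>) * indicator {p. 0 < fst p \<and> fst p powr (q - 1) / (4 * B) < g (snd p)} (s, \<tau>) \<partial>lborel)
          \<le> ennreal ((4 * B) powr (p - 1)) * ennreal (g \<tau> powr p)" .
      qed
      also have "\<dots> = ennreal ((4 * B) powr (p - 1)) * ennreal n"
        by (simp add: nn_integral_cmult 3(1)[symmetric] N_def)
      finally have "(\<integral>\<^sup>+t. ennpow (?f t) q \<partial>lborel) \<le> ennreal (4 * q * B) * (ennreal ((4 * B) powr (p - 1)) * ennreal n)"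
        by (simp add: mult_left_mono)
      also have "\<dots> = ennreal (q * (4 * B) powr p * n)"
        using B q 3 by (simp add: powr_diff flip: ennreal_mult)
      \<comment> \<open>The exponent of n is (q-1)(1-2/q) p + 1 = q - 1, as homogeneity of degree q
        in g demands.\<close>
      also have "q * (4 * B) powr p * n = q * c powr p * n powr (q - 1)"
      proof -
        have "4 * B = c * n powr ((q - 1) * (1 - 2 / q))"
          using 3 by (simp add: B_def c_def powr_mult powr_powr)
        then have "(4 * B) powr p = c powr p * n powr ((q - 1) * (1 - 2 / q) * p)"
          using c by (simp add: powr_mult powr_powr)
        also have "(q - 1) * (1 - 2 / q) * p = q - 2" using q by (simp add: p_def field_simps)
        finally show ?thesis using 3 by (simp add: powr_diff power2_eq_square)
      qed
      finally show ?thesis using 3 q by (simp add: N_def[symmetric] ennpow_ennreal flip: ennreal_mult)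
    qed
  qed
  ultimately show ?thesis using that unfolding p_def by blast
qed

section \<open>Interpolation of a supremum bound and an L^2 bound\<close>

lemma powr_le_add_square:
  fixes u p :: real
  assumes "0 \<le> u" "1 \<le> p" "p \<le> 2"
  shows "u powr p \<le> u + u\<^sup>2"
proof (cases "u \<le> 1")
  case True
  then have "u powr p \<le> u powr 1" using assms by (intro powr_mono') auto
  also have "\<dots> = u" using assms by simp
  finally show ?thesis by (simp add: add_increasing2)
next
  case False
  then have "u powr p \<le> u powr 2" using assms by (intro powr_mono) auto
  also have "\<dots> = u\<^sup>2" using assms by simp
  finally show ?thesis using assms by simp
qed

text \<open>
  Marcinkiewicz' argument: for each level \<open>s\<close>, cut \<open>\<phi>\<close> at the height \<open>l s\<close> for which the
  \<open>L\<^sup>1 \<rightarrow> L\<^sup>\<infinity>\<close> bound makes the image of the high part at most \<open>s / 2\<close>; the low part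
  is controlled by Chebyshev's inequality in \<open>L\<^sup>2\<close>.
\<close>
lemma interpolation_L1_L2:
  fixes T :: "('a \<Rightarrow> complex) \<Rightarrow> 'b \<Rightarrow> complex" and A r :: real
  assumes "sigma_finite_measure M" "sigma_finite_measure M'"
    and Tmeas: "\<And>f. integrable M f \<Longrightarrow> T f \<in> borel_measurable M'"
    and Tadd: "\<And>f g x. integrable M f \<Longrightarrow> integrable M g \<Longrightarrow> T (\<lambda>y. f y + g y) x = T f x + T g x"
    and Tbdd: "\<And>f x. integrable M f \<Longrightarrow> cmod (T f x) \<le> A * (\<integral>y. cmod (f y) \<partial>M)"
    and TL2: "\<And>f. integrable M f \<Longrightarrow> integrable M (\<lambda>y. (cmod (f y))\<^sup>2) \<Longrightarrow>
        (\<integral>\<^sup>+x. ennreal ((cmod (T f x))\<^sup>2) \<partial>M') \<le> (\<integral>\<^sup>+y. ennreal ((cmod (f y))\<^sup>2) \<partial>M)"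
    and r: "2 < r" and A: "0 < A"
    and \<phi>: "integrable M \<phi>" "integrable M (\<lambda>y. (cmod (\<phi> y))\<^sup>2)"
  shows "(\<integral>\<^sup>+x. ennreal (cmod (T \<phi> x) powr r) \<partial>M') \<le>
    ennreal (4 * r / (r - 2) * (2 * A) powr (r - 2)) * ennpow (\<integral>\<^sup>+y. ennreal (cmod (\<phi> y) powr (r / (r - 1))) \<partial>M) (r - 1)"
proof -
  interpret M: sigma_finite_measure M by fact
  interpret pair_sigma_finite M lborel ..
  define p where "p = r / (r - 1)"
  have p: "1 < p" "p < 2" and pr: "(p - 1) * (r - 1) = 1" "p * (r - 1) = r" 
    using r by (auto simp: p_def field_simps)
  have [measurable]: "\<phi> \<in> borel_measurable M" using \<phi> by auto
  define N where "N = (\<integral>\<^sup>+y. ennreal (cmod (\<phi> y) powr p) \<partial>M)"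
  have Nint: "integrable M (\<lambda>y. cmod (\<phi> y) powr p)"
  proof (rule Bochner_Integration.integrable_bound)
    show "integrable M (\<lambda>y. cmod (\<phi> y) + (cmod (\<phi> y))\<^sup>2)" using \<phi> by auto
    show "AE y in M. norm (cmod (\<phi> y) powr p) \<le> norm (cmod (\<phi> y) + (cmod (\<phi> y))\<^sup>2)"
      using p by (auto intro!: AE_I2 powr_le_add_square)
  qed measurable
  define n where "n = (\<integral>y. cmod (\<phi> y) powr p \<partial>M)"
  have Nn: "N = ennreal n" unfolding N_def n_def by (rule nn_integral_eq_integral[OF Nint]) auto
  have "0 \<le> n" unfolding n_def by auto
  show ?thesis
  \<comment> \<open>For n = 0 the cut height would vanish; then \<phi> is zero almost everywhere and
    \<open>Tbdd\<close> already annihilates \<open>T \<phi>\<close>.\<close>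
  proof (cases "n = 0")
    case True
    then have "AE y in M. cmod (\<phi> y) powr p = 0"
      using Nint unfolding n_def by (subst (asm) integral_nonneg_eq_0_iff_AE) auto
    then have "(\<integral>y. cmod (\<phi> y) \<partial>M) = 0"
      by (intro integral_eq_zero_AE) (auto elim: eventually_mono)
    then have "T \<phi> x = 0" for x using Tbdd[OF \<phi>(1), of x] by simp
    then show ?thesis by simp
  next
    case False
    with \<open>0 \<le> n\<close> have n: "0 < n" by simp
    \<comment> \<open>On the high part |\<phi>| > l, so its L^1 norm is at most l^(1-p) n. Since
      (r-1)(1-p) = -1, this choice makes l^(1-p) n equal to s/(2A), and the image is bounded by
      s/2.\<close>
    define l where "l s = (2 * A * n / s) powr (r - 1)" for s
    \<comment> \<open>The cut is an indicator on pairs (y, s), so that joint measurability is at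
      hand when the two integrals are exchanged.\<close>
    define E where "E s = (\<integral>\<^sup>+y. ennreal ((cmod (\<phi> y))\<^sup>2) * indicator {p. 0 < snd p \<and> cmod (\<phi> (fst p)) \<le> l (snd p)} (y, s) \<partial>M)" for s
    have level: "emeasure M' {x\<in>space M'. ennreal s < ennreal (cmod (T \<phi> x))} \<le> ennreal (4 / s\<^sup>2) * E s" if s: "0 < s" for s
    proof -
      define hi where "hi y = (if l s < cmod (\<phi> y) then \<phi> y else 0)" for y
      define lo where "lo y = (if l s < cmod (\<phi> y) then 0 else \<phi> y)" for y
      have ls: "0 < l s" using A n s by (simp add: l_def)
      have [measurable]: "hi \<in> borel_measurable M" "lo \<in> borel_measurable M"
        unfolding hi_def lo_def by measurable
      have hi: "integrable M hi" by (rule Bochner_Integration.integrable_bound[OF \<phi>(1)]) (auto simp: hi_def)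
      have lo: "integrable M lo" by (rule Bochner_Integration.integrable_bound[OF \<phi>(1)]) (auto simp: lo_def)
      have lo2: "integrable M (\<lambda>y. (cmod (lo y))\<^sup>2)" by (rule Bochner_Integration.integrable_bound[OF \<phi>(2)]) (auto simp: lo_def)
      have eq: "\<phi> = (\<lambda>y. hi y + lo y)" by (auto simp: hi_def lo_def)
      have hib: "cmod (T hi x) \<le> s / 2" for x
      proof -
        have "(\<integral>y. cmod (hi y) \<partial>M) \<le> (\<integral>y. l s powr (1 - p) * cmod (\<phi> y) powr p \<partial>M)"
        proof (rule integral_mono)
          fix y
          have "u \<le> l s powr (1 - p) * u powr p" if "l s < u" for u
          proof -
            have "1 * u = u powr (1 - p) * u powr p" using that ls by (simp flip: powr_add)
            also have "\<dots> \<le> l s powr (1 - p) * u powr p"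
              using that ls p by (intro mult_right_mono powr_mono2') auto
            finally show ?thesis by simp
          qed
          then show "cmod (hi y) \<le> l s powr (1 - p) * cmod (\<phi> y) powr p" by (auto simp: hi_def)
        qed (use hi Nint in auto)
        also have "\<dots> = l s powr (1 - p) * n" by (simp add: n_def)
        also have "l s powr (1 - p) = s / (2 * A * n)"
        proof -
          have "(r - 1) * (1 - p) = - 1" using pr by (simp add: algebra_simps)
          then show ?thesis using A n s by (simp add: l_def powr_powr powr_minus)
        qed
        finally have "A * (\<integral>y. cmod (hi y) \<partial>M) \<le> A * (s / (2 * A * n) * n)" using A by (intro mult_left_mono) auto
        also have "\<dots> = s / 2" using A n by simp
        finally show ?thesis using Tbdd[OF hi, of x] by simp
      qed
      have "emeasure M' {x\<in>space M'. ennreal s < ennreal (cmod (T \<phi> x))} \<le> ennreal (1 / (s\<^sup>2 / 4)) * (\<integral>\<^sup>+x. ennreal ((cmod (T lo x))\<^sup>2) \<partial>M')"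
      proof (rule emeasure_le_nn_integral_Markov)
        show "{x\<in>space M'. ennreal s < ennreal (cmod (T \<phi> x))} \<in> sets M'"
          using Tmeas[OF \<phi>(1)] by measurable
        show "(\<lambda>x. ennreal ((cmod (T lo x))\<^sup>2)) \<in> borel_measurable M'" using Tmeas[OF lo] by measurable
        fix x assume "x \<in> {x\<in>space M'. ennreal s < ennreal (cmod (T \<phi> x))}"
        then have "s < cmod (T \<phi> x)" using s by (simp add: ennreal_less_iff)
        also have "T \<phi> x = T hi x + T lo x" unfolding eq by (rule Tadd[OF hi lo])
        also have "cmod \<dots> \<le> s / 2 + cmod (T lo x)" using hib[of x] norm_triangle_ineq[of "T hi x" "T lo x"] by linarith
        finally have "s / 2 \<le> cmod (T lo x)" by simp
        then have "(s / 2)\<^sup>2 \<le> (cmod (T lo x))\<^sup>2" using s by (intro power_mono) auto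
        then show "ennreal (s\<^sup>2 / 4) \<le> ennreal ((cmod (T lo x))\<^sup>2)" by (simp add: power_divide ennreal_leI)
      qed (use s in auto)
      also have "\<dots> \<le> ennreal (1 / (s\<^sup>2 / 4)) * (\<integral>\<^sup>+y. ennreal ((cmod (lo y))\<^sup>2) \<partial>M)"
        by (intro mult_left_mono TL2[OF lo lo2]) auto
      also have "(\<integral>\<^sup>+y. ennreal ((cmod (lo y))\<^sup>2) \<partial>M) = E s"
        unfolding E_def by (rule nn_integral_cong) (use s in \<open>auto simp: lo_def indicator_def\<close>)
      finally show ?thesis by simp
    qed
    have "(\<integral>\<^sup>+x. ennreal (cmod (T \<phi> x) powr r) \<partial>M') = (\<integral>\<^sup>+x. ennpow (ennreal (cmod (T \<phi> x))) r \<partial>M')"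
      by (simp add: ennpow_ennreal)
    also have "\<dots> = (\<integral>\<^sup>+s. ennreal (r * s powr (r - 1)) * indicator {0<..} s * emeasure M' {x\<in>space M'. ennreal s < ennreal (cmod (T \<phi> x))} \<partial>lborel)"
      by (rule nn_integral_ennpow_layer_cake[OF assms(2)]) (use r Tmeas[OF \<phi>(1)] in auto)
    also have "\<dots> \<le> (\<integral>\<^sup>+s. ennreal (4 * r * s powr (r - 3)) * E s \<partial>lborel)"
    proof (rule nn_integral_mono)
      fix s :: real
      show "ennreal (r * s powr (r - 1)) * indicator {0<..} s * emeasure M' {x\<in>space M'. ennreal s < ennreal (cmod (T \<phi> x))}
         \<le> ennreal (4 * r * s powr (r - 3)) * E s"
      proof (cases "0 < s")
        case True
        have e: "r * s powr (r - 1) * (4 / s\<^sup>2) = 4 * r * s powr (r - 3)"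
          using True by (simp add: powr_diff power2_eq_square power3_eq_cube field_simps)
        have "ennreal (r * s powr (r - 1)) * emeasure M' {x\<in>space M'. ennreal s < ennreal (cmod (T \<phi> x))}
          \<le> ennreal (r * s powr (r - 1)) * (ennreal (4 / s\<^sup>2) * E s)"
          by (intro mult_left_mono level True) auto
        also have "\<dots> = ennreal (4 * r * s powr (r - 3)) * E s"
          by (rule ennreal_mult_assoc_eq[OF _ _ e]) (use r in auto)
        finally show ?thesis using True by simp
      qed simp
    qed
    also have "\<dots> = (\<integral>\<^sup>+s. \<integral>\<^sup>+y. ennreal (4 * r * s powr (r - 3)) * (ennreal ((cmod (\<phi> y))\<^sup>2) * indicator {p. 0 < snd p \<and> cmod (\<phi> (fst p)) \<le> l (snd p)} (y, s)) \<partial>M \<partial>lborel)"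
      unfolding E_def l_def by (intro nn_integral_cong nn_integral_cmult[symmetric]) measurable
    also have "\<dots> = (\<integral>\<^sup>+y. \<integral>\<^sup>+s. ennreal (4 * r * s powr (r - 3)) * (ennreal ((cmod (\<phi> y))\<^sup>2) * indicator {p. 0 < snd p \<and> cmod (\<phi> (fst p)) \<le> l (snd p)} (y, s)) \<partial>lborel \<partial>M)"
      unfolding l_def by (rule Fubini') measurable
    also have "\<dots> \<le> (\<integral>\<^sup>+y. ennreal (4 * r / (r - 2) * (2 * A * n) powr (r - 2)) * ennreal (cmod (\<phi> y) powr p) \<partial>M)"
    proof (rule nn_integral_mono)
      fix y
      define u where "u = cmod (\<phi> y)"
      show "(\<integral>\<^sup>+s. ennreal (4 * r * s powr (r - 3)) * (ennreal ((cmod (\<phi> y))\<^sup>2) * indicator {p. 0 < snd p \<and> cmod (\<phi> (fst p)) \<le> l (snd p)} (y, s)) \<partial>lborel)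
        \<le> ennreal (4 * r / (r - 2) * (2 * A * n) powr (r - 2)) * ennreal (cmod (\<phi> y) powr p)"
      proof (cases "u = 0")
        case False
        then have u: "0 < u" by (simp add: u_def)
        \<comment> \<open>The inverse of the cut height: because 1/(r-1) = p-1, u <= l(s) forces s
          <= S, so the inner integral runs over a bounded interval.\<close>
        define S where "S = 2 * A * n * u powr (1 - p)"
        have S: "0 < S" using A n u by (simp add: S_def)
        have "s \<le> S" if "0 < s" "u \<le> l s" for s
        proof -
          have "(p - 1) * (r - 1) = 1" by (rule pr)
          then have "(l s) powr (p - 1) = 2 * A * n / s"
            using that A n by (simp add: l_def powr_powr mult.commute)
          moreover have "u powr (p - 1) \<le> (l s) powr (p - 1)" using that u p by (intro powr_mono2) auto
          ultimately have "u powr (p - 1) \<le> 2 * A * n / s" by simp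
          then have "s * u powr (p - 1) \<le> 2 * A * n" using that by (simp add: field_simps)
          then have "s \<le> 2 * A * n / u powr (p - 1)" using u by (simp add: field_simps)
          then show ?thesis using u by (simp add: S_def powr_diff divide_simps)
        qed
        then have "(\<integral>\<^sup>+s. ennreal (4 * r * s powr (r - 3)) * (ennreal ((cmod (\<phi> y))\<^sup>2) * indicator {p. 0 < snd p \<and> cmod (\<phi> (fst p)) \<le> l (snd p)} (y, s)) \<partial>lborel)
           \<le> (\<integral>\<^sup>+s. ennreal (4 * r * u\<^sup>2) * (ennreal (s powr (r - 3)) * indicator {0..S} s) \<partial>lborel)"
          unfolding u_def[symmetric] using r
          by (intro nn_integral_mono) (auto simp: indicator_def u_def mult.commute mult.left_commute simp flip: ennreal_mult)
        \<comment> \<open>Here r > 2 is used: s^(r-3) is integrable at 0, and the factor 1/(r-2)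
          arises.\<close>
        also have "\<dots> = ennreal (4 * r * u\<^sup>2) * ennreal (S powr (r - 2) / (r - 2))"
          using nn_integral_powr_from_0[of "r - 3" S] r S by (simp add: nn_integral_cmult)
        also have "\<dots> = ennreal (4 * r * u\<^sup>2 * (S powr (r - 2) / (r - 2)))"
          using r S by (simp flip: ennreal_mult)
        also have "4 * r * u\<^sup>2 * (S powr (r - 2) / (r - 2)) = 4 * r / (r - 2) * (2 * A * n) powr (r - 2) * u powr p"
        proof -
          have "(1 - p) * (r - 2) = p - 2" using pr by (simp add: algebra_simps)
          then have "S powr (r - 2) = (2 * A * n) powr (r - 2) * u powr (p - 2)"
            using A n u by (simp add: S_def powr_mult powr_powr)
          also have "u powr (p - 2) = u powr p / u\<^sup>2" using u by (simp add: powr_diff power2_eq_square)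
          finally show ?thesis using u by simp
        qed
        also have "ennreal (4 * r / (r - 2) * (2 * A * n) powr (r - 2) * u powr p)
          = ennreal (4 * r / (r - 2) * (2 * A * n) powr (r - 2)) * ennreal (cmod (\<phi> y) powr p)"
          unfolding u_def by (rule ennreal_mult) (use r A n in auto)
        finally show ?thesis .
      qed (simp add: u_def)
    qed
    also have "\<dots> = ennreal (4 * r / (r - 2) * (2 * A * n) powr (r - 2)) * ennreal n"
      by (simp add: nn_integral_cmult Nn[symmetric] N_def)
    also have "\<dots> = ennreal (4 * r / (r - 2) * (2 * A) powr (r - 2)) * ennreal (n powr (r - 1))"
      using r A n by (simp add: powr_mult powr_diff power2_eq_square flip: ennreal_mult)
    finally show ?thesis using n by (simp add: N_def[symmetric] Nn ennpow_ennreal flip: p_def)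
  qed
qed

section \<open>Gaussians and Bessel functions\<close>

text \<open>The measure lives on the whole line and vanishes on the nonpositive half, so
  measurability is plain Borel measurability and almost-everywhere statements may assume
  positivity.\<close>

definition omega :: "real \<Rightarrow> real measure" where
  "omega a = density lborel (\<lambda>x. ennreal (indicator {0<..} x * x powr a))"

lemma omega_simps [simp]: "space (omega a) = UNIV" "sets (omega a) = sets borel"
  by (auto simp: omega_def)

lemma measurable_omega [measurable_cong, simp]:
  "sets (omega a) = sets borel" "measurable (omega a) N = measurable borel N" "measurable N (omega a) = measurable N borel"
  by (auto simp: omega_def cong: measurable_cong_sets)

lemma sigma_finite_omega: "sigma_finite_measure (omega a)"
  unfolding omega_def by (subst sigma_finite_measure.sigma_finite_iff_density_finite[OF sigma_finite_lborel]) auto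

interpretation omega: sigma_finite_measure "omega a" for a by (rule sigma_finite_omega)

lemma nn_integral_omega:
  assumes [measurable]: "f \<in> borel_measurable borel"
  shows "(\<integral>\<^sup>+x. f x \<partial>omega a) = (\<integral>\<^sup>+x. ennreal (indicator {0<..} x * x powr a) * f x \<partial>lborel)"
  unfolding omega_def by (rule nn_integral_density) auto

lemma integral_omega:
  fixes f :: "real \<Rightarrow> 'b :: {banach, second_countable_topology}"
  assumes [measurable]: "f \<in> borel_measurable borel"
  shows "(\<integral>x. f x \<partial>omega a) = (\<integral>x. (indicator {0<..} x * x powr a) *\<^sub>R f x \<partial>lborel)"
  unfolding omega_def by (rule integral_density) auto

lemma AE_omega: "(AE x in lborel. 0 < x \<longrightarrow> P x) \<Longrightarrow> (AE x in omega a. P x)"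
  unfolding omega_def by (subst AE_density) (auto elim!: eventually_mono simp: indicator_def split: if_splits)

lemma AE_omega_pos: "AE x in omega a. 0 < x"
  by (rule AE_omega) simp

text \<open>Euler's integral for \<open>Gamma s\<close> under the substitution of \<epsilon> x^2 for
  its variable.\<close>

lemma nn_integral_powr_gaussian:
  fixes s \<epsilon> :: real
  assumes s: "0 < s" and \<epsilon>: "0 < \<epsilon>"
  shows "(\<integral>\<^sup>+x. ennreal (indicator {0<..} x * (x powr (2 * s - 1) * exp (- \<epsilon> * x\<^sup>2))) \<partial>lborel) = ennreal (Gamma s / (2 * \<epsilon> powr s))"
proof -
  let ?f = "\<lambda>t. t powr (s - 1) * exp (- t)"
  have img: "(\<lambda>x. \<epsilon> * x\<^sup>2) ` {0<..} = {0<..}"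
  proof (intro equalityI subsetI)
    fix y :: real assume "y \<in> {0<..}"
    then show "y \<in> (\<lambda>x. \<epsilon> * x\<^sup>2) ` {0<..}"
      using \<epsilon> by (intro image_eqI[of _ _ "sqrt (y / \<epsilon>)"]) auto
  qed (use \<epsilon> in auto)
  have "(?f has_integral Gamma s) {0..}"
    using Gamma_integral_real[OF s] by (simp add: exp_minus divide_inverse)
  then have f: "(?f has_integral Gamma s) {0<..}"
    by (subst (asm) has_integral_spike_set_eq[where T = "{0<..}"])
       (auto intro!: negligible_subset[OF negligible_sing[of 0]])
  then have "?f absolutely_integrable_on {0<..} \<and> integral {0<..} ?f = Gamma s"
    by (auto intro!: nonnegative_absolutely_integrable_1 simp: has_integral_integrable_integral)
  moreover have "(\<lambda>x. \<bar>2 * \<epsilon> * x\<bar> * ?f (\<epsilon> * x\<^sup>2)) absolutely_integrable_on {0<..} \<and>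
      integral {0<..} (\<lambda>x. \<bar>2 * \<epsilon> * x\<bar> * ?f (\<epsilon> * x\<^sup>2)) = Gamma s \<longleftrightarrow>
      ?f absolutely_integrable_on (\<lambda>x. \<epsilon> * x\<^sup>2) ` {0<..} \<and> integral ((\<lambda>x. \<epsilon> * x\<^sup>2) ` {0<..}) ?f = Gamma s"
  proof (rule has_absolute_integral_change_of_variables_1')
    show "inj_on (\<lambda>x. \<epsilon> * x\<^sup>2) {0<..}"
      using \<epsilon> by (auto simp: inj_on_def)
  qed (auto intro!: derivative_eq_intros)
  ultimately have "(\<lambda>x. \<bar>2 * \<epsilon> * x\<bar> * ?f (\<epsilon> * x\<^sup>2)) absolutely_integrable_on {0<..}"
     "integral {0<..} (\<lambda>x. \<bar>2 * \<epsilon> * x\<bar> * ?f (\<epsilon> * x\<^sup>2)) = Gamma s"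
    unfolding img by auto
  then have "((\<lambda>x. \<bar>2 * \<epsilon> * x\<bar> * ?f (\<epsilon> * x\<^sup>2)) has_integral Gamma s) {0<..}"
    using set_lebesgue_integral_eq_integral(1) has_integral_integrable_integral by blast
  from has_integral_mult_right[OF this, of "1 / (2 * \<epsilon> powr s)"]
  have *: "((\<lambda>x. 1 / (2 * \<epsilon> powr s) * (\<bar>2 * \<epsilon> * x\<bar> * ?f (\<epsilon> * x\<^sup>2))) has_integral Gamma s / (2 * \<epsilon> powr s)) {0<..}"
    by simp
  have "((\<lambda>x. x powr (2 * s - 1) * exp (- \<epsilon> * x\<^sup>2)) has_integral Gamma s / (2 * \<epsilon> powr s)) {0<..}"
  proof (rule has_integral_eq[OF _ *])
    fix x :: real assume "x \<in> {0<..}"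
    then have x: "0 < x" by simp
    have "(\<epsilon> * x\<^sup>2) powr (s - 1) = \<epsilon> powr (s - 1) * (x powr 2) powr (s - 1)"
      using x by (simp add: powr_mult)
    also have "(x powr 2) powr (s - 1) = x powr (2 * s - 1 - 1)"
      unfolding powr_powr by (simp add: right_diff_distrib)
    finally have e: "(\<epsilon> * x\<^sup>2) powr (s - 1) = \<epsilon> powr s / \<epsilon> * (x powr (2 * s - 1) / x)"
      using \<epsilon> x by (simp only: powr_diff powr_one)
    have "\<bar>2 * \<epsilon> * x\<bar> = 2 * \<epsilon> * x" using \<epsilon> x by simp
    then show "1 / (2 * \<epsilon> powr s) * (\<bar>2 * \<epsilon> * x\<bar> * ?f (\<epsilon> * x\<^sup>2)) = x powr (2 * s - 1) * exp (- \<epsilon> * x\<^sup>2)"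
      unfolding e using \<epsilon> x by simp
  qed
  from nn_integral_has_integral_lebesgue[OF _ this] show ?thesis by simp
qed

text \<open>The weight x^a combines with x^(2k) to x^(2s-1) for s = k + (a+1)/2. Only even moments
  occur because the normalised Bessel function is a series in z^2.\<close>

lemma has_bochner_integral_gaussian_moment:
  fixes a \<epsilon> :: real and k :: nat
  assumes a: "0 \<le> a" and \<epsilon>: "0 < \<epsilon>"
  shows "has_bochner_integral (omega a) (\<lambda>x. x ^ (2 * k) * exp (- \<epsilon> * x\<^sup>2))
    (Gamma (real k + (a + 1) / 2) / (2 * \<epsilon> powr (real k + (a + 1) / 2)))"
proof (rule has_bochner_integral_nn_integral)
  have "(\<integral>\<^sup>+x. ennreal (x ^ (2 * k) * exp (- \<epsilon> * x\<^sup>2)) \<partial>omega a) =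
     (\<integral>\<^sup>+x. ennreal (indicator {0<..} x * (x powr (2 * (real k + (a + 1) / 2) - 1) * exp (- \<epsilon> * x\<^sup>2))) \<partial>lborel)"
  proof (subst nn_integral_omega, measurable, rule nn_integral_cong)
    fix x :: real
    have "x powr a * (x ^ (2 * k) * E) = x powr (2 * (real k + (a + 1) / 2) - 1) * E" if "0 < x" for E
    proof -
      have "x powr (2 * (real k + (a + 1) / 2) - 1) = x powr (a + real (2 * k))"
        by (rule arg_cong[of _ _ "(powr) x"]) (simp add: field_simps)
      also have "\<dots> = x powr a * x ^ (2 * k)"
        using that by (simp only: powr_add powr_realpow)
      finally show ?thesis by simp
    qed
    note key = this
    show "ennreal (indicator {0<..} x * x powr a) * ennreal (x ^ (2 * k) * exp (- \<epsilon> * x\<^sup>2))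
      = ennreal (indicator {0<..} x * (x powr (2 * (real k + (a + 1) / 2) - 1) * exp (- \<epsilon> * x\<^sup>2)))"
    proof (cases "0 < x")
      case True
      have "ennreal (x powr a) * ennreal (x ^ (2 * k) * exp (- \<epsilon> * x\<^sup>2)) = ennreal (x powr a * (x ^ (2 * k) * exp (- \<epsilon> * x\<^sup>2)))"
        by (rule ennreal_mult[symmetric]) auto
      also have "\<dots> = ennreal (x powr (2 * (real k + (a + 1) / 2) - 1) * exp (- \<epsilon> * x\<^sup>2))"
        unfolding key[OF True] ..
      finally show ?thesis using True by simp
    qed simp
  qed
  also have "\<dots> = ennreal (Gamma (real k + (a + 1) / 2) / (2 * \<epsilon> powr (real k + (a + 1) / 2)))"
    using a \<epsilon> by (intro nn_integral_powr_gaussian add_nonneg_pos) auto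
  finally show "(\<integral>\<^sup>+x. ennreal (x ^ (2 * k) * exp (- \<epsilon> * x\<^sup>2)) \<partial>omega a) = \<dots>" .
  show "0 \<le> Gamma (real k + (a + 1) / 2) / (2 * \<epsilon> powr (real k + (a + 1) / 2))"
    using a by (intro divide_nonneg_nonneg less_imp_le[OF Gamma_real_pos] add_nonneg_pos) auto
qed auto

text \<open>With \<nu> = (a-1)/2 one has k + \<nu> + 1 = k + (a+1)/2, and the powers of 2 are those
  split off from (z/2)^(2k+\<nu>).\<close>

definition bessel_coeff :: "real \<Rightarrow> nat \<Rightarrow> real" where
  "bessel_coeff a k = (- 1) ^ k / (fact k * Gamma (real k + (a + 1) / 2)) * 2 powr (- (a - 1) / 2) / 4 ^ k"

text \<open>\<open>bessel_entire a (z\<^sup>2)\<close> is the normalised Bessel function \<open>z\<^bsup>-\<nu>\<^esup> J\<^sub>\<nu>(z)\<close> with \<open>\<nu> = (a - 1) / 2\<close>.\<close>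
definition bessel_entire :: "real \<Rightarrow> real \<Rightarrow> real" where
  "bessel_entire a w = (\<Sum>k. bessel_coeff a k * w ^ k)"

section \<open>Series, bound and Gaussian image of the normalised Bessel function\<close>

context
  fixes a :: real
  assumes a: "0 \<le> a"
begin

lemma Gamma_coeff_pos: "0 < Gamma (real k + (a + 1) / 2)"
  using a by (intro Gamma_real_pos add_nonneg_pos) auto

text \<open>The functional equation of Gamma. This recurrence is Bessel's equation read off
  coefficientwise, and it also controls the growth of the coefficients.\<close>

lemma bessel_coeff_Suc:
  "4 * real (Suc k) * (real k + (a + 1) / 2) * bessel_coeff a (Suc k) = - bessel_coeff a k"
proof -
  define s where "s = (a + 1) / 2"
  have "Gamma (real k + s + 1) = (real k + s) * Gamma (real k + s)"
  proof (rule Gamma_plus1)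
    have "0 < real k + s" using a by (intro add_nonneg_pos) (auto simp: s_def)
    then show "real k + s \<notin> \<int>\<^sub>\<le>\<^sub>0" using nonpos_Ints_nonpos[of "real k + s"] by linarith
  qed
  then have "Gamma (real (Suc k) + s) = (real k + s) * Gamma (real k + s)"
    by (simp add: add_ac)
  moreover have "0 < real k + s" using a by (intro add_nonneg_pos) (auto simp: s_def)
  moreover have "0 < Gamma (real k + s)" using Gamma_coeff_pos[of k] by (simp add: s_def)
  ultimately show ?thesis
    unfolding bessel_coeff_def s_def[symmetric] by (simp add: divide_simps)
qed

text \<open>For a >= 0 the factor 4 (k + (a+1)/2) in the recurrence is at least 1, so each step
  gains 1/(k+1). The exponential series is thus a majorant and the Bessel series converges
  everywhere.\<close>

lemma bessel_coeff_bound: "\<bar>bessel_coeff a k\<bar> \<le> bessel_coeff a 0 / fact k"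
proof (induction k)
  case 0
  then show ?case using Gamma_coeff_pos[of 0] by (simp add: bessel_coeff_def)
next
  case (Suc k)
  have "1 \<le> 4 * ((a + 1) / 2)" using a by simp
  then have k: "1 \<le> 4 * (real k + (a + 1) / 2)" by (simp add: distrib_left add_increasing)
  have "real (Suc k) * \<bar>bessel_coeff a (Suc k)\<bar> * 1 \<le> real (Suc k) * \<bar>bessel_coeff a (Suc k)\<bar> * (4 * (real k + (a + 1) / 2))"
    by (intro mult_left_mono k) auto
  also have "\<dots> = \<bar>4 * real (Suc k) * (real k + (a + 1) / 2) * bessel_coeff a (Suc k)\<bar>"
  proof -
    have "0 \<le> real k + (a + 1) / 2" using a by (intro add_nonneg_nonneg) auto
    then show ?thesis by (auto simp only: abs_mult abs_of_nonneg abs_numeral of_nat_0_le_iff mult_ac)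
  qed
  also have "\<dots> \<le> bessel_coeff a 0 / fact k" unfolding bessel_coeff_Suc using Suc by simp
  finally have "real (Suc k) * \<bar>bessel_coeff a (Suc k)\<bar> * fact k \<le> bessel_coeff a 0"
    by (simp add: pos_le_divide_eq del: of_nat_Suc)
  then show ?case
    by (subst pos_le_divide_eq) (simp_all add: mult_ac del: of_nat_Suc)
qed

lemma summable_norm_bessel: "summable (\<lambda>k. \<bar>bessel_coeff a k * w ^ k\<bar>)"
proof (rule summable_comparison_test)
  show "summable (\<lambda>k. bessel_coeff a 0 * (inverse (fact k) * \<bar>w\<bar> ^ k))"
    by (intro summable_mult summable_exp)
  have "norm \<bar>bessel_coeff a k * w ^ k\<bar> \<le> bessel_coeff a 0 * (inverse (fact k) * \<bar>w\<bar> ^ k)" for k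
    using mult_right_mono[OF bessel_coeff_bound[of k], of "\<bar>w\<bar> ^ k"]
    by (simp add: abs_mult power_abs divide_inverse mult.assoc)
  then show "\<exists>N. \<forall>k\<ge>N. norm \<bar>bessel_coeff a k * w ^ k\<bar> \<le> bessel_coeff a 0 * (inverse (fact k) * \<bar>w\<bar> ^ k)" by blast
qed

lemma summable_bessel: "summable (\<lambda>k. bessel_coeff a k * w ^ k)"
  using summable_norm_bessel[of w] by (simp add: summable_rabs_cancel)

text \<open>The prefactor cancels the non-integer power of z in each term. What remains is an even
  entire function of z, which makes sense for every real argument.\<close>

lemma besselJ_conv_entire:
  assumes z: "0 < z"
  shows "z powr ((1 - a) / 2) * besselJ ((a - 1) / 2) z = bessel_entire a (z\<^sup>2)"
proof -
  have eq: "bessel_coeff a k * (z\<^sup>2) ^ k = z powr ((1 - a) / 2) *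
     ((- 1) ^ k / (fact k * Gamma (real k + (a - 1) / 2 + 1)) * (z / 2) powr (2 * real k + (a - 1) / 2))" for k
  proof -
    have 1: "real k + (a - 1) / 2 + 1 = real k + (a + 1) / 2" by (simp add: field_simps)
    have "(z / 2) powr (2 * real k + (a - 1) / 2) = (z / 2) powr (real (2 * k)) * (z / 2) powr ((a - 1) / 2)"
      by (simp add: powr_add)
    also have "(z / 2) powr (real (2 * k)) = (z\<^sup>2) ^ k / 4 ^ k"
      using z by (subst powr_realpow) (auto simp: power_divide power_mult)
    also have "(z / 2) powr ((a - 1) / 2) = z powr ((a - 1) / 2) * 2 powr (- (a - 1) / 2)"
    proof -
      have "(z / 2) powr ((a - 1) / 2) = z powr ((a - 1) / 2) * (1 / 2 powr ((a - 1) / 2))"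
        using z by (simp add: powr_divide)
      also have "1 / 2 powr ((a - 1) / 2) = 2 powr (- ((a - 1) / 2))" by (rule powr_minus_divide[symmetric])
      also have "- ((a - 1) / 2) = - (a - 1) / 2" by (rule minus_divide_left)
      finally show ?thesis .
    qed
    finally have 2: "(z / 2) powr (2 * real k + (a - 1) / 2) = (z\<^sup>2) ^ k / 4 ^ k * (z powr ((a - 1) / 2) * 2 powr (- (a - 1) / 2))" .
    have 3: "z powr ((1 - a) / 2) * z powr ((a - 1) / 2) = 1"
    proof -
      have "z powr ((1 - a) / 2) * z powr ((a - 1) / 2) = z powr ((1 - a) / 2 + (a - 1) / 2)"
        by (rule powr_add[symmetric])
      also have "(1 - a) / 2 + (a - 1) / 2 = 0" by (simp add: field_simps)
      finally show ?thesis using z by simp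
    qed
    have "z powr ((1 - a) / 2) *
     ((- 1) ^ k / (fact k * Gamma (real k + (a - 1) / 2 + 1)) * (z / 2) powr (2 * real k + (a - 1) / 2))
     = (z powr ((1 - a) / 2) * z powr ((a - 1) / 2)) * (bessel_coeff a k * (z\<^sup>2) ^ k)"
      unfolding 1 2 bessel_coeff_def by (simp add: mult_ac)
    then show ?thesis by (simp add: 3)
  qed
  have sm: "summable (\<lambda>k. z powr ((1 - a) / 2) *
     ((- 1) ^ k / (fact k * Gamma (real k + (a - 1) / 2 + 1)) * (z / 2) powr (2 * real k + (a - 1) / 2)))"
    unfolding eq[symmetric] by (rule summable_bessel)
  then have "summable (\<lambda>k. (- 1) ^ k / (fact k * Gamma (real k + (a - 1) / 2 + 1)) * (z / 2) powr (2 * real k + (a - 1) / 2))"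
    using z by (subst (asm) summable_cmult_iff) auto
  from suminf_mult[OF this, of "z powr ((1 - a) / 2)"] show ?thesis
    unfolding bessel_entire_def besselJ_def eq by simp
qed

lemma DERIV_bessel_entire:
  "(bessel_entire a has_real_derivative (\<Sum>k. diffs (bessel_coeff a) k * w ^ k)) (at w)"
  unfolding bessel_entire_def[abs_def]
  by (rule termdiffs_strong_converges_everywhere) (rule summable_bessel)

text \<open>In the variable w the equation reads 4 w G'' + 2 (1+a) G' + G = 0, and the data at w = 0
  are read off from the power series. Differentiating the energy G^2 + 4 w G'^2 and inserting the
  equation leaves -4 a G'^2, so on w >= 0 the energy never exceeds its initial value G(0)^2.\<close>

lemma bessel_entire_bound:
  assumes w: "0 \<le> w"
  shows "\<bar>bessel_entire a w\<bar> \<le> bessel_coeff a 0"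
proof -
  let ?c = "bessel_coeff a"
  define G1 where "G1 w = (\<Sum>k. diffs ?c k * w ^ k)" for w
  define G2 where "G2 w = (\<Sum>k. diffs (diffs ?c) k * w ^ k)" for w
  have s1: "summable (\<lambda>k. diffs ?c k * w ^ k)" for w
    by (rule termdiff_converges_all) (rule summable_bessel)
  have s2: "summable (\<lambda>k. diffs (diffs ?c) k * w ^ k)" for w
    by (rule termdiff_converges_all) (rule s1)
  have D0: "(bessel_entire a has_real_derivative G1 w) (at w)" for w
    unfolding G1_def by (rule DERIV_bessel_entire)
  have D1: "(G1 has_real_derivative G2 w) (at w)" for w
    unfolding G1_def[abs_def] G2_def
    by (rule termdiffs_strong_converges_everywhere) (rule s1)
  have ode: "4 * (w * G2 w) + 2 * (1 + a) * G1 w + bessel_entire a w = 0" for w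
  proof -
    have "(\<lambda>k. real k * diffs ?c k * w ^ (k - Suc 0)) sums G2 w"
      unfolding G2_def by (rule diffs_equiv) (rule s2)
    \<comment> \<open>Multiplication by w restores the full power; at k = 0, where
      \<open>k - Suc 0\<close> is again 0, the factor k removes the term.\<close>
    from sums_mult[OF this, of w] have A: "(\<lambda>k. real k * diffs ?c k * w ^ k) sums (w * G2 w)"
    proof (rule back_subst[of "\<lambda>f. f sums (w * G2 w)"])
      show "(\<lambda>k. w * (real k * diffs ?c k * w ^ (k - Suc 0))) = (\<lambda>k. real k * diffs ?c k * w ^ k)"
      proof
        fix k show "w * (real k * diffs ?c k * w ^ (k - Suc 0)) = real k * diffs ?c k * w ^ k"
          by (cases k) auto
      qed
    qed
    have B: "(\<lambda>k. diffs ?c k * w ^ k) sums G1 w" unfolding G1_def using s1 by (rule summable_sums)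
    have C: "(\<lambda>k. ?c k * w ^ k) sums bessel_entire a w" unfolding bessel_entire_def using summable_bessel by (rule summable_sums)
    have "(\<lambda>k. 4 * (real k * diffs ?c k * w ^ k) + 2 * (1 + a) * (diffs ?c k * w ^ k) + ?c k * w ^ k)
      sums (4 * (w * G2 w) + 2 * (1 + a) * G1 w + bessel_entire a w)"
      by (intro sums_add sums_mult A B C)
    moreover have "4 * (real k * diffs ?c k * w ^ k) + 2 * (1 + a) * (diffs ?c k * w ^ k) + ?c k * w ^ k = 0" for k
    proof -
      have "4 * (real k * diffs ?c k * w ^ k) + 2 * (1 + a) * (diffs ?c k * w ^ k) + ?c k * w ^ k
         = (4 * real (Suc k) * (real k + (a + 1) / 2) * ?c (Suc k) + ?c k) * w ^ k"
      proof -
        define s where "s = (a + 1) / 2"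
        have "1 + a = 2 * s" by (simp add: s_def)
        then show ?thesis unfolding s_def[symmetric] by (simp add: diffs_def algebra_simps)
      qed
      then show ?thesis unfolding bessel_coeff_Suc by simp
    qed
    ultimately show ?thesis by (simp add: sums_iff)
  qed
  \<comment> \<open>the energy of the Bessel equation in the variable \<open>w = z\<^sup>2\<close>; it decreases because \<open>a \<ge> 0\<close>\<close>
  define E where "E w = (bessel_entire a w)\<^sup>2 + 4 * w * (G1 w)\<^sup>2" for w
  have "E w \<le> E 0"
  proof (rule DERIV_nonpos_imp_nonincreasing[OF w])
    fix x :: real
    have "(E has_real_derivative (2 * bessel_entire a x * G1 x + 4 * (G1 x)\<^sup>2 + 8 * x * G1 x * G2 x)) (at x)"
      unfolding E_def[abs_def]
      by (auto intro!: derivative_eq_intros D0 D1 simp: power2_eq_square algebra_simps)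
    moreover have "2 * bessel_entire a x * G1 x + 4 * (G1 x)\<^sup>2 + 8 * x * G1 x * G2 x
       = 2 * G1 x * (4 * (x * G2 x) + 2 * (1 + a) * G1 x + bessel_entire a x) - 4 * a * (G1 x)\<^sup>2"
      by (simp add: algebra_simps power2_eq_square)
    ultimately show "\<exists>y. (E has_real_derivative y) (at x) \<and> y \<le> 0"
      unfolding ode using a by auto
  qed
  moreover have "E 0 = (?c 0)\<^sup>2" by (simp add: E_def bessel_entire_def powser_zero)
  moreover have "(bessel_entire a w)\<^sup>2 \<le> E w" using w by (simp add: E_def)
  ultimately have "\<bar>bessel_entire a w\<bar> \<le> \<bar>?c 0\<bar>" by (simp add: abs_le_square_iff)
  then show ?thesis using Gamma_coeff_pos[of 0] by (simp add: bessel_coeff_def)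
qed

lemma bessel_entire_measurable [measurable]: "bessel_entire a \<in> borel_measurable borel"
proof -
  have "isCont (bessel_entire a) x" for x
    using DERIV_bessel_entire by (rule DERIV_isCont)
  then show ?thesis by (intro borel_measurable_continuous_onI continuous_at_imp_continuous_on) auto
qed

text \<open>Weber's integral, computed term by term: the Gamma factors of the Gaussian moments
  cancel those in the coefficients and an exponential series remains. The integrals of the absolute
  values form the same series with \<xi>^2/(4 \<epsilon>) in place of its negative, which justifies
  the exchange.\<close>

lemma bessel_gaussian:
  assumes \<epsilon>: "0 < \<epsilon>"
  shows "(\<integral>y. bessel_entire a ((\<xi> * y)\<^sup>2) * exp (- \<epsilon> * y\<^sup>2) \<partial>omega a)
    = (2 * \<epsilon>) powr (- ((a + 1) / 2)) * exp (- \<xi>\<^sup>2 / (4 * \<epsilon>))"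
proof -
  let ?s = "(a + 1) / 2"
  let ?f = "\<lambda>k y. bessel_coeff a k * ((\<xi> * y)\<^sup>2) ^ k * exp (- \<epsilon> * y\<^sup>2)"
  have f: "?f k y = bessel_coeff a k * \<xi> ^ (2 * k) * (y ^ (2 * k) * exp (- \<epsilon> * y\<^sup>2))" for k y
    by (simp add: power_mult_distrib power_mult)
  have absf: "norm (?f k y) = \<bar>bessel_coeff a k\<bar> * \<xi> ^ (2 * k) * (y ^ (2 * k) * exp (- \<epsilon> * y\<^sup>2))" for k y
    unfolding f by (simp add: abs_mult power_mult)
  note mom = has_bochner_integral_gaussian_moment[OF a \<epsilon>]
  have int: "(\<integral>y. ?f k y \<partial>omega a) = bessel_coeff a k * \<xi> ^ (2 * k) * (Gamma (real k + ?s) / (2 * \<epsilon> powr (real k + ?s)))" for k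
    unfolding f by (intro has_bochner_integral_integral_eq has_bochner_integral_mult_right mom)
  have inta: "(\<integral>y. norm (?f k y) \<partial>omega a) = \<bar>bessel_coeff a k\<bar> * \<xi> ^ (2 * k) * (Gamma (real k + ?s) / (2 * \<epsilon> powr (real k + ?s)))" for k
    unfolding absf by (intro has_bochner_integral_integral_eq has_bochner_integral_mult_right mom)
  define C where "C = (2 * \<epsilon>) powr (- ((a + 1) / 2))"
  \<comment> \<open>The power 2^(-(a-1)/2) equals 2 * 2^(-(a+1)/2); the extra 2 cancels the 2 in the
    denominator of the Gaussian moment.\<close>
  have pw: "2 powr (- (a - 1) / 2) / (2 * \<epsilon> powr (real k + ?s)) = C * (1 / \<epsilon> ^ k)" for k
  proof -
    have e1: "\<epsilon> powr (real k + ?s) = \<epsilon> ^ k * \<epsilon> powr ?s"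
      using \<epsilon> by (simp add: powr_add powr_realpow)
    have "2 powr (- (a - 1) / 2) = 2 powr (1 + - ?s)"
      by (rule arg_cong[of _ _ "(powr) 2"]) (simp add: field_simps)
    also have "\<dots> = 2 powr 1 * 2 powr (- ?s)" by (rule powr_add)
    finally have e2: "2 powr (- (a - 1) / 2) = 2 * 2 powr (- ?s)" by simp
    have "C = 2 powr (- ?s) * \<epsilon> powr (- ?s)" unfolding C_def by (rule powr_mult)
    then have e3: "C = 2 powr (- ?s) / \<epsilon> powr ?s" by (simp only: powr_minus_divide) simp
    show ?thesis unfolding e1 e2 e3 by simp
  qed
  have val: "bessel_coeff a k * \<xi> ^ (2 * k) * (Gamma (real k + ?s) / (2 * \<epsilon> powr (real k + ?s)))
      = C * ((- \<xi>\<^sup>2 / (4 * \<epsilon>)) ^ k /\<^sub>R fact k)" for k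
  proof -
    have "bessel_coeff a k * \<xi> ^ (2 * k) * (Gamma (real k + ?s) / (2 * \<epsilon> powr (real k + ?s)))
      = (2 powr (- (a - 1) / 2) / (2 * \<epsilon> powr (real k + ?s))) * ((- 1) ^ k * (\<xi>\<^sup>2) ^ k / (4 ^ k * fact k))"
      using Gamma_coeff_pos[of k] unfolding bessel_coeff_def by (simp add: power_mult divide_simps)
    also have "\<dots> = C * ((- 1) ^ k * (\<xi>\<^sup>2) ^ k / (4 ^ k * \<epsilon> ^ k) / fact k)"
      unfolding pw by (simp add: mult_ac)
    also have "(- 1) ^ k * (\<xi>\<^sup>2) ^ k / (4 ^ k * \<epsilon> ^ k) = (- \<xi>\<^sup>2 / (4 * \<epsilon>)) ^ k"
      by (simp only: power_divide power_minus[of "\<xi>\<^sup>2"] power_mult_distrib)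
    finally have e: "bessel_coeff a k * \<xi> ^ (2 * k) * (Gamma (real k + ?s) / (2 * \<epsilon> powr (real k + ?s)))
      = C * ((- \<xi>\<^sup>2 / (4 * \<epsilon>)) ^ k / fact k)" .
    have "X / fact k = X /\<^sub>R fact k" for X :: real by (simp add: divide_inverse_commute)
    then show ?thesis unfolding e by (rule arg_cong)
  qed
  have vala: "(\<integral>y. norm (?f k y) \<partial>omega a) = C * ((\<xi>\<^sup>2 / (4 * \<epsilon>)) ^ k /\<^sub>R fact k)" for k
  proof -
    have "(\<integral>y. norm (?f k y) \<partial>omega a) = \<bar>bessel_coeff a k * \<xi> ^ (2 * k) * (Gamma (real k + ?s) / (2 * \<epsilon> powr (real k + ?s)))\<bar>"
      unfolding inta using Gamma_coeff_pos[of k] by (simp add: abs_mult power_mult)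
    also have "\<dots> = C * ((\<xi>\<^sup>2 / (4 * \<epsilon>)) ^ k /\<^sub>R fact k)"
      unfolding val using \<epsilon> by (simp add: abs_mult power_abs C_def)
    finally show ?thesis .
  qed
  have "(\<integral>y. bessel_entire a ((\<xi> * y)\<^sup>2) * exp (- \<epsilon> * y\<^sup>2) \<partial>omega a) = (\<integral>y. (\<Sum>k. ?f k y) \<partial>omega a)"
    unfolding bessel_entire_def by (simp add: suminf_mult2[OF summable_bessel])
  also have "\<dots> = (\<Sum>k. \<integral>y. ?f k y \<partial>omega a)"
  proof (rule integral_suminf)
    show "integrable (omega a) (?f k)" for k
      unfolding f by (rule integrable_mult_right, rule integrable.intros, rule mom)
    show "AE y in omega a. summable (\<lambda>k. norm (?f k y))"
    proof (rule AE_I2)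
      fix y
      have "norm (?f k y) = \<bar>bessel_coeff a k * ((\<xi> * y)\<^sup>2) ^ k\<bar> * exp (- \<epsilon> * y\<^sup>2)" for k
        by (simp only: abs_mult real_norm_def abs_exp_cancel)
      then show "summable (\<lambda>k. norm (?f k y))"
        by (simp only:) (intro summable_mult2 summable_norm_bessel)
    qed
    show "summable (\<lambda>k. \<integral>y. norm (?f k y) \<partial>omega a)"
      unfolding vala using summable_exp_generic by (intro summable_mult)
  qed
  also have "\<dots> = (\<Sum>k. C * ((- \<xi>\<^sup>2 / (4 * \<epsilon>)) ^ k /\<^sub>R fact k))"
    unfolding int val ..
  also have "\<dots> = C * exp (- \<xi>\<^sup>2 / (4 * \<epsilon>))"
    unfolding exp_def by (rule suminf_mult) (rule summable_exp_generic)
  finally show ?thesis unfolding C_def .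
qed

end

section \<open>The Hankel transform\<close>

text \<open>Restricted to real functions because the kernel is real; complex data are treated
  through real and imaginary parts.\<close>

definition hankel :: "real \<Rightarrow> (real \<Rightarrow> real) \<Rightarrow> real \<Rightarrow> real" where
  "hankel a \<psi> \<xi> = (\<integral>y. bessel_entire a ((\<xi> * y)\<^sup>2) * \<psi> y \<partial>omega a)"

text \<open>A property of a single function, so that it can be carried through limits from Gaussian
  sums to continuous, then bounded, then general functions.\<close>

definition hankel_contracts :: "real \<Rightarrow> (real \<Rightarrow> real) \<Rightarrow> bool" where
  "hankel_contracts a \<psi> \<longleftrightarrow>
    (\<integral>\<^sup>+\<xi>. ennreal ((hankel a \<psi> \<xi>)\<^sup>2) \<partial>omega a) \<le> (\<integral>\<^sup>+y. ennreal ((\<psi> y)\<^sup>2) \<partial>omega a)"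

section \<open>Contraction of the Hankel transform by approximation\<close>

context
  fixes a :: real
  assumes a: "0 \<le> a"
begin

lemmas [measurable] = bessel_entire_measurable[OF a]

lemma hankel_measurable [measurable]:
  assumes [measurable]: "\<psi> \<in> borel_measurable borel"
  shows "hankel a \<psi> \<in> borel_measurable borel"
  unfolding hankel_def by measurable

text \<open>Integrability of D and the bounded kernel give pointwise convergence of the transforms,
  so Fatou's lemma applies on the left; integrability of D^2 gives convergence of the squared norms
  on the right.\<close>

lemma hankel_contracts_limit:
  assumes [measurable]: "\<And>n. f n \<in> borel_measurable borel" "\<psi> \<in> borel_measurable borel"
    and lim: "AE y in omega a. (\<lambda>n. f n y) \<longlonglongrightarrow> \<psi> y"
    and bd: "\<And>n. AE y in omega a. \<bar>f n y\<bar> \<le> D y"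
    and D: "integrable (omega a) D" "integrable (omega a) (\<lambda>y. (D y)\<^sup>2)"
    and f: "\<And>n. hankel_contracts a (f n)"
  shows "hankel_contracts a \<psi>"
proof -
  have [measurable]: "D \<in> borel_measurable borel" using borel_measurable_integrable[OF D(1)] by simp
  have "(\<lambda>n. hankel a (f n) \<xi>) \<longlonglongrightarrow> hankel a \<psi> \<xi>" for \<xi>
    unfolding hankel_def
  proof (rule integral_dominated_convergence)
    show "integrable (omega a) (\<lambda>y. bessel_coeff a 0 * D y)" using D by simp
    show "AE y in omega a. (\<lambda>n. bessel_entire a ((\<xi> * y)\<^sup>2) * f n y) \<longlonglongrightarrow> bessel_entire a ((\<xi> * y)\<^sup>2) * \<psi> y"
      using lim by eventually_elim (intro tendsto_intros)
    show "AE y in omega a. norm (bessel_entire a ((\<xi> * y)\<^sup>2) * f n y) \<le> bessel_coeff a 0 * D y" for n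
      using bd[of n]
    proof eventually_elim
      case (elim y)
      have "0 \<le> bessel_coeff a 0" using bessel_entire_bound[OF a, of 0] by linarith
      then show ?case unfolding real_norm_def abs_mult
        by (intro mult_mono bessel_entire_bound[OF a] elim) auto
    qed
  qed measurable
  then have "liminf (\<lambda>n. ennreal ((hankel a (f n) \<xi>)\<^sup>2)) = ennreal ((hankel a \<psi> \<xi>)\<^sup>2)" for \<xi>
    by (intro lim_imp_Liminf tendsto_intros) auto
  then have "(\<integral>\<^sup>+\<xi>. ennreal ((hankel a \<psi> \<xi>)\<^sup>2) \<partial>omega a) = (\<integral>\<^sup>+\<xi>. liminf (\<lambda>n. ennreal ((hankel a (f n) \<xi>)\<^sup>2)) \<partial>omega a)"
    by simp
  also have "\<dots> \<le> liminf (\<lambda>n. \<integral>\<^sup>+\<xi>. ennreal ((hankel a (f n) \<xi>)\<^sup>2) \<partial>omega a)"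
    by (rule nn_integral_liminf) measurable
  also have "\<dots> \<le> liminf (\<lambda>n. \<integral>\<^sup>+y. ennreal ((f n y)\<^sup>2) \<partial>omega a)"
    using f by (intro Liminf_mono) (auto simp: hankel_contracts_def)
  also have "\<dots> = (\<integral>\<^sup>+y. ennreal ((\<psi> y)\<^sup>2) \<partial>omega a)"
  proof (rule lim_imp_Liminf)
    show "(\<lambda>n. \<integral>\<^sup>+y. ennreal ((f n y)\<^sup>2) \<partial>omega a) \<longlonglongrightarrow> (\<integral>\<^sup>+y. ennreal ((\<psi> y)\<^sup>2) \<partial>omega a)"
    proof (rule nn_integral_dominated_convergence)
      show "AE y in omega a. ennreal ((f n y)\<^sup>2) \<le> ennreal ((D y)\<^sup>2)" for n
        using bd[of n] by eventually_elim (metis abs_ge_zero ennreal_leI power2_abs power_mono)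
      show "(\<integral>\<^sup>+y. ennreal ((D y)\<^sup>2) \<partial>omega a) < \<infinity>"
        using D(2) by (subst nn_integral_eq_integral) auto
      show "AE y in omega a. (\<lambda>n. ennreal ((f n y)\<^sup>2)) \<longlonglongrightarrow> ennreal ((\<psi> y)\<^sup>2)"
        using lim by eventually_elim (intro tendsto_intros)
    qed measurable
  qed simp
  finally show ?thesis unfolding hankel_contracts_def .
qed

lemma integrable_gaussian: "0 < \<epsilon> \<Longrightarrow> integrable (omega a) (\<lambda>y. exp (- \<epsilon> * y\<^sup>2))"
  and integral_gaussian: "0 < \<epsilon> \<Longrightarrow> (\<integral>y. exp (- \<epsilon> * y\<^sup>2) \<partial>omega a) = Gamma ((a + 1) / 2) / (2 * \<epsilon> powr ((a + 1) / 2))"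
  using has_bochner_integral_gaussian_moment[OF a, of \<epsilon> 0]
  by (auto simp: has_bochner_integral_iff)

lemma hankel_gaussian_sum:
  assumes "finite I" and e: "\<And>i. i \<in> I \<Longrightarrow> 0 < e i"
  shows "hankel a (\<lambda>y. \<Sum>i\<in>I. b i * exp (- e i * y\<^sup>2)) \<xi>
    = (\<Sum>i\<in>I. b i * (2 * e i) powr (- ((a + 1) / 2)) * exp (- (1 / (4 * e i)) * \<xi>\<^sup>2))"
proof -
  have int: "integrable (omega a) (\<lambda>y. bessel_entire a ((\<xi> * y)\<^sup>2) * exp (- e i * y\<^sup>2))" if "i \<in> I" for i
  proof (rule Bochner_Integration.integrable_bound)
    show "integrable (omega a) (\<lambda>y. bessel_coeff a 0 * exp (- e i * y\<^sup>2))"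
      using integrable_gaussian[OF e[OF that]] by simp
    have "norm (bessel_entire a ((\<xi> * y)\<^sup>2) * exp (- e i * y\<^sup>2)) \<le> norm (bessel_coeff a 0 * exp (- e i * y\<^sup>2))" for y
      using bessel_entire_bound[OF a, of "(\<xi> * y)\<^sup>2"] by (simp add: abs_mult)
    then show "AE y in omega a. norm (bessel_entire a ((\<xi> * y)\<^sup>2) * exp (- e i * y\<^sup>2)) \<le> norm (bessel_coeff a 0 * exp (- e i * y\<^sup>2))"
      by simp
  qed measurable
  have "hankel a (\<lambda>y. \<Sum>i\<in>I. b i * exp (- e i * y\<^sup>2)) \<xi> = (\<integral>y. (\<Sum>i\<in>I. b i * (bessel_entire a ((\<xi> * y)\<^sup>2) * exp (- e i * y\<^sup>2))) \<partial>omega a)"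
    unfolding hankel_def by (simp add: sum_distrib_left mult_ac)
  also have "\<dots> = (\<Sum>i\<in>I. \<integral>y. b i * (bessel_entire a ((\<xi> * y)\<^sup>2) * exp (- e i * y\<^sup>2)) \<partial>omega a)"
    by (rule Bochner_Integration.integral_sum) (intro integrable_mult_right int)
  also have "\<dots> = (\<Sum>i\<in>I. b i * ((2 * e i) powr (- ((a + 1) / 2)) * exp (- \<xi>\<^sup>2 / (4 * e i))))"
    by (intro sum.cong refl) (simp only: integral_mult_right_zero bessel_gaussian[OF a e])
  finally show ?thesis by (simp add: mult.assoc)
qed

lemma integral_gaussian_sum_square:
  assumes "finite I" and e: "\<And>i. i \<in> I \<Longrightarrow> 0 < e i"
  shows "integrable (omega a) (\<lambda>y. (\<Sum>i\<in>I. b i * exp (- e i * y\<^sup>2))\<^sup>2)"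
    and "(\<integral>y. (\<Sum>i\<in>I. b i * exp (- e i * y\<^sup>2))\<^sup>2 \<partial>omega a)
      = (\<Sum>i\<in>I. \<Sum>j\<in>I. b i * b j * (Gamma ((a + 1) / 2) / (2 * (e i + e j) powr ((a + 1) / 2))))"
proof -
  have eq: "(\<Sum>i\<in>I. b i * exp (- e i * y\<^sup>2))\<^sup>2 = (\<Sum>i\<in>I. \<Sum>j\<in>I. b i * b j * exp (- (e i + e j) * y\<^sup>2))" for y
    unfolding power2_eq_square sum_product
    by (intro sum.cong refl) (simp add: exp_add[symmetric] algebra_simps)
  have pos: "0 < e i + e j" if "i \<in> I" "j \<in> I" for i j using e that by (simp add: add_pos_pos)
  show "integrable (omega a) (\<lambda>y. (\<Sum>i\<in>I. b i * exp (- e i * y\<^sup>2))\<^sup>2)"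
    unfolding eq by (intro Bochner_Integration.integrable_sum integrable_mult_right integrable_gaussian pos)
  show "(\<integral>y. (\<Sum>i\<in>I. b i * exp (- e i * y\<^sup>2))\<^sup>2 \<partial>omega a)
      = (\<Sum>i\<in>I. \<Sum>j\<in>I. b i * b j * (Gamma ((a + 1) / 2) / (2 * (e i + e j) powr ((a + 1) / 2))))"
    unfolding eq
    by (subst Bochner_Integration.integral_sum,
        intro Bochner_Integration.integrable_sum integrable_mult_right integrable_gaussian pos, assumption+,
        intro sum.cong refl,
        subst Bochner_Integration.integral_sum,
        intro integrable_mult_right integrable_gaussian pos, assumption+,
        intro sum.cong refl, simp only: integral_mult_right_zero integral_gaussian[OF pos])
qed

text \<open>Equality holds. A Gaussian of exponent e goes to (2e)^(-(a+1)/2) times one of exponent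
  1/(4e), and (4 e_i e_j)(1/(4 e_i) + 1/(4 e_j)) = e_i + e_j, so the transform preserves all inner
  products of Gaussians.\<close>

lemma hankel_contracts_gaussian_sum:
  assumes I: "finite I" and e: "\<And>i. i \<in> I \<Longrightarrow> 0 < e i"
  shows "hankel_contracts a (\<lambda>y. \<Sum>i\<in>I. b i * exp (- e i * y\<^sup>2))"
proof -
  let ?s = "(a + 1) / 2"
  let ?b = "\<lambda>i. b i * (2 * e i) powr (- ?s)" and ?e = "\<lambda>i. 1 / (4 * e i)"
  have e': "0 < ?e i" if "i \<in> I" for i using e[OF that] by simp
  have H: "hankel a (\<lambda>y. \<Sum>i\<in>I. b i * exp (- e i * y\<^sup>2)) \<xi> = (\<Sum>i\<in>I. ?b i * exp (- ?e i * \<xi>\<^sup>2))" for \<xi>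
    by (rule hankel_gaussian_sum[OF I e])
  have "(\<integral>\<^sup>+\<xi>. ennreal ((hankel a (\<lambda>y. \<Sum>i\<in>I. b i * exp (- e i * y\<^sup>2)) \<xi>)\<^sup>2) \<partial>omega a)
     = ennreal (\<integral>\<xi>. (\<Sum>i\<in>I. ?b i * exp (- ?e i * \<xi>\<^sup>2))\<^sup>2 \<partial>omega a)"
    unfolding H
  proof (rule nn_integral_eq_integral)
    show "integrable (omega a) (\<lambda>\<xi>. (\<Sum>i\<in>I. ?b i * exp (- ?e i * \<xi>\<^sup>2))\<^sup>2)"
      by (rule integral_gaussian_sum_square(1)[OF I e'])
  qed auto
  also have "(\<integral>\<xi>. (\<Sum>i\<in>I. ?b i * exp (- ?e i * \<xi>\<^sup>2))\<^sup>2 \<partial>omega a)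
     = (\<Sum>i\<in>I. \<Sum>j\<in>I. b i * b j * (Gamma ?s / (2 * (e i + e j) powr ?s)))"
  proof (rule trans[OF integral_gaussian_sum_square(2)[of I ?e ?b, OF I e']], assumption, intro sum.cong refl)
    fix i j assume "i \<in> I" "j \<in> I"
    then have e: "0 < e i" "0 < e j" using assms by auto
    have "(2 * e i) powr (- ?s) * (2 * e j) powr (- ?s) = (4 * e i * e j) powr (- ?s)"
      using e by (simp only: powr_mult[symmetric]) (simp add: mult_ac)
    also have "\<dots> = 1 / (4 * e i * e j) powr ?s" by (rule powr_minus_divide)
    finally have 1: "(2 * e i) powr (- ?s) * (2 * e j) powr (- ?s) = 1 / (4 * e i * e j) powr ?s" .
    have "(4 * e i * e j) powr ?s * (?e i + ?e j) powr ?s = ((4 * e i * e j) * (?e i + ?e j)) powr ?s"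
      by (rule powr_mult[symmetric])
    also have "(4 * e i * e j) * (?e i + ?e j) = e i + e j" using e by (simp add: field_simps)
    finally have 2: "(4 * e i * e j) powr ?s * (?e i + ?e j) powr ?s = (e i + e j) powr ?s" .
    have "?b i * ?b j * (Gamma ?s / (2 * (?e i + ?e j) powr ?s))
      = b i * b j * ((2 * e i) powr (- ?s) * (2 * e j) powr (- ?s)) * (Gamma ?s / (2 * (?e i + ?e j) powr ?s))"
      by (simp only: mult_ac)
    also have "\<dots> = b i * b j * (Gamma ?s / (2 * ((4 * e i * e j) powr ?s * (?e i + ?e j) powr ?s)))"
      unfolding 1 by simp
    finally show "?b i * ?b j * (Gamma ?s / (2 * (?e i + ?e j) powr ?s)) = b i * b j * (Gamma ?s / (2 * (e i + e j) powr ?s))"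
      unfolding 2 .
  qed
  also have "ennreal \<dots> = (\<integral>\<^sup>+y. ennreal ((\<Sum>i\<in>I. b i * exp (- e i * y\<^sup>2))\<^sup>2) \<partial>omega a)"
  proof -
    have "integrable (omega a) (\<lambda>y. (\<Sum>i\<in>I. b i * exp (- e i * y\<^sup>2))\<^sup>2)"
      by (rule integral_gaussian_sum_square(1)[OF I e])
    moreover have "(\<integral>y. (\<Sum>i\<in>I. b i * exp (- e i * y\<^sup>2))\<^sup>2 \<partial>omega a)
      = (\<Sum>i\<in>I. \<Sum>j\<in>I. b i * b j * (Gamma ?s / (2 * (e i + e j) powr ?s)))"
      by (rule integral_gaussian_sum_square(2)[OF I e])
    ultimately show ?thesis by (subst nn_integral_eq_integral) auto
  qed
  finally show ?thesis unfolding hankel_contracts_def by simp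
qed

text \<open>Polynomials in u = exp(-y^2) without constant term are exactly sums of Gaussians.
  Approximating h/u instead of h guarantees the missing constant term and makes the approximants at
  most a constant times u, which supplies the integrable majorant.\<close>

lemma hankel_contracts_continuous:
  assumes cont: "continuous_on UNIV h" and R: "0 < R" and supp: "\<And>y. R \<le> y \<Longrightarrow> h y = 0"
  shows "hankel_contracts a h"
proof -
  \<comment> \<open>The image of the endpoint R under u = exp(-y^2). Freezing g below \<delta>,
    where h is zero, keeps the logarithm and the quotient continuous down to u = 0.\<close>
  define \<delta> where "\<delta> = exp (- (R\<^sup>2))"
  have \<delta>: "0 < \<delta>" "\<delta> \<le> 1" by (auto simp: \<delta>_def)
  \<comment> \<open>\<open>h y = u * g u\<close> for \<open>u = exp (- y\<^sup>2)\<close>, so polynomial approximation of \<open>g\<close> gives sums of Gaussians\<close>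
  define g where "g u = h (sqrt (- ln (max u \<delta>))) / max u \<delta>" for u
  have contg: "continuous_on {0..1} g"
    unfolding g_def using \<delta> by (intro continuous_intros continuous_on_compose2[OF cont]) (auto simp: max_def)
  have g: "exp (- 1 * y\<^sup>2) * g (exp (- 1 * y\<^sup>2)) = h y" if "0 < y" for y
  proof (cases "y \<le> R")
    case True
    then have "\<delta> \<le> exp (- 1 * y\<^sup>2)" using that by (simp add: \<delta>_def)
    then show ?thesis using that by (simp add: g_def max_def)
  next
    case False
    then have "exp (- 1 * y\<^sup>2) \<le> \<delta>" using R by (simp add: \<delta>_def)
    then have "g (exp (- 1 * y\<^sup>2)) = h R / \<delta>" using R by (simp add: g_def max_def \<delta>_def)
    then show ?thesis using False supp[of y] supp[of R] by simp
  qed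
  have "\<exists>p. real_polynomial_function p \<and> (\<forall>x\<in>{0..1}. \<bar>g x - p x\<bar> < 1 / (real n + 1))" for n
    by (rule Stone_Weierstrass_real_polynomial_function[OF compact_Icc contg, of "1 / (real n + 1)"]) auto
  then obtain p where p: "\<And>n. real_polynomial_function (p n)"
    and pg: "\<And>n x. x \<in> {0..1} \<Longrightarrow> \<bar>g x - p n x\<bar> < 1 / (real n + 1)" by metis
  obtain B where B: "\<And>x. x \<in> {0..1} \<Longrightarrow> \<bar>g x\<bar> \<le> B"
    using compact_imp_bounded[OF compact_continuous_image[OF contg compact_Icc]]
    unfolding bounded_iff real_norm_def by (metis imageI)
  define f where "f n y = exp (- 1 * y\<^sup>2) * p n (exp (- 1 * y\<^sup>2))" for n y
  have u01: "exp (- 1 * y\<^sup>2) \<in> {0..1}" for y :: real by simp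
  have contr: "hankel_contracts a (f n)" and meas: "f n \<in> borel_measurable borel" for n
  proof -
    obtain b m where bm: "p n = (\<lambda>x. \<Sum>i\<le>m. b i * x ^ i)"
      using p[of n] unfolding real_polynomial_function_iff_sum by (metis (no_types))
    have feq: "f n = (\<lambda>y. \<Sum>i\<in>{..m}. b i * exp (- real (Suc i) * y\<^sup>2))"
    proof
      fix y
      have "exp (- 1 * y\<^sup>2) * exp (- 1 * y\<^sup>2) ^ i = exp (- real (Suc i) * y\<^sup>2)" for i
        by (simp add: exp_of_nat_mult[symmetric] exp_add[symmetric] algebra_simps)
      then have "exp (- 1 * y\<^sup>2) * (b i * exp (- 1 * y\<^sup>2) ^ i) = b i * exp (- real (Suc i) * y\<^sup>2)" for i
        by (metis mult.left_commute)
      then show "f n y = (\<Sum>i\<in>{..m}. b i * exp (- real (Suc i) * y\<^sup>2))"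
        unfolding f_def bm sum_distrib_left by (intro sum.cong refl)
    qed
    show "hankel_contracts a (f n)" unfolding feq by (rule hankel_contracts_gaussian_sum) auto
    show "f n \<in> borel_measurable borel" unfolding feq by measurable
  qed
  have [measurable]: "h \<in> borel_measurable borel" using cont by (rule borel_measurable_continuous_onI)
  let ?D = "\<lambda>y. (B + 1) * exp (- 1 * y\<^sup>2)"
  show ?thesis
  proof (rule hankel_contracts_limit[where f = f and D = ?D])
    show "AE y in omega a. (\<lambda>n. f n y) \<longlonglongrightarrow> h y"
      using AE_omega_pos
    proof eventually_elim
      case (elim y)
      have "(\<lambda>n. p n (exp (- 1 * y\<^sup>2))) \<longlonglongrightarrow> g (exp (- 1 * y\<^sup>2))"
      proof (rule LIM_zero_cancel, rule Lim_null_comparison)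
        show "(\<lambda>n. 1 / (real n + 1)) \<longlonglongrightarrow> 0" by real_asymp
        show "\<forall>\<^sub>F n in sequentially. norm (p n (exp (- 1 * y\<^sup>2)) - g (exp (- 1 * y\<^sup>2))) \<le> 1 / (real n + 1)"
          using pg[OF u01[of y]] by (auto simp: abs_minus_commute intro!: always_eventually less_imp_le)
      qed
      from tendsto_mult[OF tendsto_const this, of "exp (- 1 * y\<^sup>2)"]
      show ?case unfolding f_def g[OF elim] .
    qed
    have "\<bar>f n y\<bar> \<le> ?D y" for n y
    proof -
      have "1 / (real n + 1) \<le> 1" by simp
      then have "\<bar>p n (exp (- 1 * y\<^sup>2))\<bar> \<le> B + 1"
        using pg[OF u01[of y], of n] B[OF u01[of y]] by linarith
      then show ?thesis unfolding f_def by (simp add: abs_mult)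
    qed
    then show "AE y in omega a. \<bar>f n y\<bar> \<le> ?D y" for n by simp
    show "integrable (omega a) ?D" by (intro integrable_mult_right integrable_gaussian) simp
    have "(?D y)\<^sup>2 = (B + 1)\<^sup>2 * exp (- 2 * y\<^sup>2)" for y
      by (simp add: power_mult_distrib exp_of_nat_mult[symmetric] flip: exp_double)
    then show "integrable (omega a) (\<lambda>y. (?D y)\<^sup>2)"
      by (simp only:) (intro integrable_mult_right integrable_gaussian, simp)
  qed (use contr meas in auto)
qed

text \<open>Measurability provides continuous approximants off a null set, but with no control of
  size or support. Clipping at height B and multiplying by a continuous cutoff restore both without
  changing the limit.\<close>

lemma hankel_contracts_bounded:
  assumes [measurable]: "\<psi> \<in> borel_measurable borel" and R: "0 < R" and B: "0 \<le> B"
    and supp: "\<And>y. R < y \<Longrightarrow> \<psi> y = 0" and bd: "\<And>y. \<bar>\<psi> y\<bar> \<le> B"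
  shows "hankel_contracts a \<psi>"
proof -
  have "\<psi> measurable_on UNIV"
    by (rule lebesgue_measurable_imp_measurable_on) (auto intro!: measurable_completion)
  then obtain N g where N: "negligible N" and g: "\<And>n. continuous_on UNIV (g n)"
    and lim: "\<And>x. x \<notin> N \<Longrightarrow> (\<lambda>n. g n x) \<longlonglongrightarrow> \<psi> x"
    unfolding measurable_on_def by auto
  have "N \<in> null_sets lebesgue" using N by (simp add: negligible_iff_null_sets)
  then have N: "AE x in lborel. x \<notin> N" using AE_not_in AE_completion_iff by blast
  \<comment> \<open>Equal to 1 up to R and to 0 beyond R + 1.\<close>
  define \<kappa> where "\<kappa> y = max 0 (min 1 (R + 1 - y))" for y :: real
  define f where "f n y = max (- B) (min B (g n y)) * \<kappa> y" for n y
  have fc: "continuous_on UNIV (f n)" for n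
    unfolding f_def \<kappa>_def by (intro continuous_intros g)
  \<comment> \<open>A Gaussian normalised to be at least B on the interval from 0 to R + 1, so that
    the known integrals serve for domination.\<close>
  let ?D = "\<lambda>y. B * exp ((R + 1)\<^sup>2) * exp (- 1 * y\<^sup>2)"
  show ?thesis
  proof (rule hankel_contracts_limit[where f = f and D = ?D])
    show "f n \<in> borel_measurable borel" for n using fc by (rule borel_measurable_continuous_onI)
    show "hankel_contracts a (f n)" for n
      by (rule hankel_contracts_continuous[OF fc, of "R + 1"]) (use R in \<open>auto simp: f_def \<kappa>_def\<close>)
    show "AE y in omega a. (\<lambda>n. f n y) \<longlonglongrightarrow> \<psi> y"
    proof (rule AE_omega, use N in eventually_elim, rule impI)
      fix y assume y: "y \<notin> N"
      have "(\<lambda>n. f n y) \<longlonglongrightarrow> max (- B) (min B (\<psi> y)) * \<kappa> y"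
        unfolding f_def by (intro tendsto_intros lim y)
      also have "max (- B) (min B (\<psi> y)) = \<psi> y" using bd[of y] by auto
      also have "\<psi> y * \<kappa> y = \<psi> y" using supp[of y] by (cases "R < y") (auto simp: \<kappa>_def)
      finally show "(\<lambda>n. f n y) \<longlonglongrightarrow> \<psi> y" .
    qed
    show "AE y in omega a. \<bar>f n y\<bar> \<le> ?D y" for n
      using AE_omega_pos
    proof eventually_elim
      case (elim y)
      show ?case
      proof (cases "y \<le> R + 1")
        case True
        then have "y\<^sup>2 \<le> (R + 1)\<^sup>2" using elim by (intro power_mono) auto
        then have "1 \<le> exp ((R + 1)\<^sup>2) * exp (- 1 * y\<^sup>2)" by (simp flip: exp_add)
        then have "B * 1 \<le> B * (exp ((R + 1)\<^sup>2) * exp (- 1 * y\<^sup>2))" using B by (rule mult_left_mono)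
        moreover have "\<bar>f n y\<bar> \<le> B * 1"
          unfolding f_def abs_mult using B by (intro mult_mono) (auto simp: \<kappa>_def)
        ultimately show ?thesis by (simp add: mult.assoc)
      next
        case False
        then show ?thesis using B by (simp add: f_def \<kappa>_def)
      qed
    qed
    show "integrable (omega a) ?D" by (intro integrable_mult_right integrable_gaussian) simp
    have "(?D y)\<^sup>2 = (B * exp ((R + 1)\<^sup>2))\<^sup>2 * exp (- 2 * y\<^sup>2)" for y
      by (simp add: power_mult_distrib flip: exp_double)
    then show "integrable (omega a) (\<lambda>y. (?D y)\<^sup>2)"
      by (simp only:) (intro integrable_mult_right integrable_gaussian, simp)
  qed fact
qed

lemma hankel_contracts_L1_L2:
  assumes \<psi>: "integrable (omega a) \<psi>" "integrable (omega a) (\<lambda>y. (\<psi> y)\<^sup>2)"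
  shows "hankel_contracts a \<psi>"
proof -
  have [measurable]: "\<psi> \<in> borel_measurable borel" using borel_measurable_integrable[OF \<psi>(1)] by simp
  define f where "f n y = (if \<bar>\<psi> y\<bar> \<le> real n \<and> y \<le> real n then \<psi> y else 0)" for n y
  show ?thesis
  proof (rule hankel_contracts_limit[where f = f and D = "\<lambda>y. \<bar>\<psi> y\<bar>"])
    show [measurable]: "f n \<in> borel_measurable borel" for n unfolding f_def by measurable
    \<comment> \<open>The radius n + 1 is positive also for n = 0.\<close>
    show "hankel_contracts a (f n)" for n
      by (rule hankel_contracts_bounded[of _ "real n + 1" "real n"]) (auto simp: f_def)
    show "AE y in omega a. (\<lambda>n. f n y) \<longlonglongrightarrow> \<psi> y"
    proof (rule AE_I2)
      fix y
      obtain m where m: "max \<bar>\<psi> y\<bar> y \<le> real m" using real_arch_simple by blast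
      then have "\<forall>n\<ge>m. f n y = \<psi> y" by (auto simp: f_def)
      then show "(\<lambda>n. f n y) \<longlonglongrightarrow> \<psi> y"
        by (intro tendsto_eventually) (auto simp: eventually_sequentially)
    qed
    show "AE y in omega a. \<bar>f n y\<bar> \<le> \<bar>\<psi> y\<bar>" for n by (auto simp: f_def)
  qed (use \<psi> in auto)
qed

end

section \<open>The propagator and its space-time estimate\<close>

lemma cis_measurable [measurable (raw)]:
  "f \<in> borel_measurable M \<Longrightarrow> (\<lambda>x. cis (f x)) \<in> borel_measurable M"
  by (rule measurable_compose, assumption, rule borel_measurable_continuous_onI) (intro continuous_intros)

text \<open>The weighted half-line scales like a space of dimension a + 1.\<close>

lemma nn_integral_omega_dilate:
  assumes [measurable]: "f \<in> borel_measurable borel" and c: "0 < c"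
  shows "(\<integral>\<^sup>+x. f (x / c) \<partial>omega a) = ennreal (c powr (a + 1)) * (\<integral>\<^sup>+x. f x \<partial>omega a)"
proof -
  have "(\<integral>\<^sup>+x. f (x / c) \<partial>omega a) = (\<integral>\<^sup>+x. ennreal (indicator {0<..} x * x powr a) * f (x / c) \<partial>lborel)"
    by (rule nn_integral_omega) measurable
  also have "\<dots> = ennreal c * (\<integral>\<^sup>+x. ennreal (indicator {0<..} (c * x) * (c * x) powr a) * f x \<partial>lborel)"
    using c by (subst nn_integral_real_affine[of _ c 0]) auto
  also have "(\<lambda>x. ennreal (indicator {0<..} (c * x) * (c * x) powr a) * f x)
     = (\<lambda>x. ennreal (c powr a) * (ennreal (indicator {0<..} x * x powr a) * f x))"
    using c by (auto simp: fun_eq_iff indicator_def zero_less_mult_iff powr_mult ennreal_mult mult.assoc)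
  also have "(\<integral>\<^sup>+x. ennreal (c powr a) * (ennreal (indicator {0<..} x * x powr a) * f x) \<partial>lborel)
     = ennreal (c powr a) * (\<integral>\<^sup>+x. f x \<partial>omega a)"
    by (simp add: nn_integral_cmult nn_integral_omega)
  also have "ennreal c * \<dots> = ennreal (c powr (a + 1)) * (\<integral>\<^sup>+x. f x \<partial>omega a)"
    by (rule ennreal_mult_assoc_eq) (use c in \<open>auto simp: powr_add\<close>)
  finally show ?thesis .
qed

text \<open>Using \<open>sgn t\<close> in the phase and t, not its absolute value, in the chirp
  covers both signs of time in one formula.\<close>

definition schr_factor :: "real \<Rightarrow> real \<Rightarrow> real \<Rightarrow> complex" where
  "schr_factor a t x = cis (- sgn t * ((a + 1) * pi / 4)) * of_real ((2 * \<bar>t\<bar>) powr (- ((a + 1) / 2))) * cis (x\<^sup>2 / (4 * t))"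

text \<open>Chirp, Hankel transform at the dilated point x/(2|t|), chirp. There is no branch at t =
  0, and every real x and y is allowed, so joint measurability in space and time is direct.\<close>

definition schr :: "real \<Rightarrow> real \<Rightarrow> (real \<Rightarrow> complex) \<Rightarrow> real \<Rightarrow> complex" where
  "schr a t \<phi> x = schr_factor a t x *
     (\<integral>y. complex_of_real (bessel_entire a ((x / (2 * \<bar>t\<bar>) * y)\<^sup>2)) * (cis (y\<^sup>2 / (4 * t)) * \<phi> y) \<partial>omega a)"

lemma norm_schr_factor: "cmod (schr_factor a t x) = (2 * \<bar>t\<bar>) powr (- ((a + 1) / 2))"
  by (simp add: schr_factor_def norm_mult)

context
  fixes a :: real
  assumes a: "0 \<le> a"
begin

lemmas [measurable] = bessel_entire_measurable[OF a]

text \<open>The values of \<phi> at y <= 0 are arbitrary and do not enter \<open>Sop\<close>;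
  measurability is therefore asked only of the extension by zero.\<close>

lemma Sop_eq_schr:
  assumes [measurable]: "(\<lambda>y. if 0 < y then \<phi> y else 0) \<in> borel_measurable borel" and t: "t \<noteq> 0" and x: "0 < x"
  shows "Sop a t \<phi> x = schr a t (\<lambda>y. if 0 < y then \<phi> y else 0) x"
proof -
  define \<psi> where "\<psi> y = (if 0 < y then \<phi> y else 0)" for y
  have [measurable]: "\<psi> \<in> borel_measurable borel" unfolding \<psi>_def by measurable
  have K: "Skernel a x y t = schr_factor a t x *
      (complex_of_real (bessel_entire a ((x / (2 * \<bar>t\<bar>) * y)\<^sup>2)) * cis (y\<^sup>2 / (4 * t)))" if y: "0 < y" for y
  proof -
    define z where "z = x * y / (2 * \<bar>t\<bar>)"
    have z: "0 < z" using x y t by (simp add: z_def)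
    have zz: "x / (2 * \<bar>t\<bar>) * y = z" by (simp add: z_def)
    define amp where "amp = complex_of_real (z powr ((1 - a) / 2) * besselJ ((a - 1) / 2) z / (2 * \<bar>t\<bar>) powr ((a + 1) / 2))"
    have amp: "amp = of_real ((2 * \<bar>t\<bar>) powr (- ((a + 1) / 2))) * of_real (bessel_entire a (z\<^sup>2))"
      unfolding amp_def besselJ_conv_entire[OF a z] powr_minus_divide by simp
    have "Skernel a x y t = cis (- sgn t * ((a + 1) * pi / 4)) * amp * cis ((x\<^sup>2 + y\<^sup>2) / (4 * t))"
    proof (cases "0 < t")
      case True
      then have "(x\<^sup>2 + y\<^sup>2) / (4 * t) = (x\<^sup>2 + y\<^sup>2) / (4 * \<bar>t\<bar>)" by simp
      moreover have "sgn t = 1" using True by simp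
      ultimately show ?thesis using True
        unfolding Skernel_def Let_def z_def[symmetric] amp_def[symmetric] cis_conv_exp by simp
    next
      case False
      then have "(x\<^sup>2 + y\<^sup>2) / (4 * t) = - ((x\<^sup>2 + y\<^sup>2) / (4 * \<bar>t\<bar>))" using t by simp
      moreover have "sgn t = -1" "\<not> 0 < t" using False t by auto
      ultimately show ?thesis
        unfolding Skernel_def Let_def z_def[symmetric] amp_def[symmetric] cis_conv_exp by simp
    qed
    also have "cis ((x\<^sup>2 + y\<^sup>2) / (4 * t)) = cis (x\<^sup>2 / (4 * t)) * cis (y\<^sup>2 / (4 * t))"
      by (simp add: cis_mult add_divide_distrib)
    finally show ?thesis unfolding amp schr_factor_def zz by (simp add: mult_ac)
  qed
  have "Sop a t \<phi> x = (LINT y:{0<..}|lborel. Skernel a x y t * \<phi> y * complex_of_real (y powr a))"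
    using t by (simp add: Sop_def)
  also have "\<dots> = (LINT y|lborel. (indicator {0<..} y * y powr a) *\<^sub>R (schr_factor a t x *
      (complex_of_real (bessel_entire a ((x / (2 * \<bar>t\<bar>) * y)\<^sup>2)) * (cis (y\<^sup>2 / (4 * t)) * \<psi> y))))"
    unfolding set_lebesgue_integral_def
    by (rule Bochner_Integration.integral_cong) (auto simp: indicator_def K \<psi>_def scaleR_conv_of_real mult_ac)
  also have "\<dots> = (\<integral>y. schr_factor a t x *
      (complex_of_real (bessel_entire a ((x / (2 * \<bar>t\<bar>) * y)\<^sup>2)) * (cis (y\<^sup>2 / (4 * t)) * \<psi> y)) \<partial>omega a)"
    by (rule integral_omega[symmetric]) measurable
  also have "\<dots> = schr a t \<psi> x" unfolding schr_def by simp
  finally show ?thesis unfolding \<psi>_def .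
qed

lemma bessel_coeff_0_pos: "0 < bessel_coeff a 0"
  using Gamma_coeff_pos[OF a, of 0] by (simp add: bessel_coeff_def)

lemma integrable_schr:
  assumes "integrable (omega a) \<phi>"
  shows "integrable (omega a) (\<lambda>y. complex_of_real (bessel_entire a ((\<xi> * y)\<^sup>2)) * (cis (y\<^sup>2 / (4 * t)) * \<phi> y))"
proof (rule Bochner_Integration.integrable_bound)
  have [measurable]: "\<phi> \<in> borel_measurable borel" using borel_measurable_integrable[OF assms] by simp
  show "integrable (omega a) (\<lambda>y. bessel_coeff a 0 * cmod (\<phi> y))" using assms by simp
  show "(\<lambda>y. complex_of_real (bessel_entire a ((\<xi> * y)\<^sup>2)) * (cis (y\<^sup>2 / (4 * t)) * \<phi> y)) \<in> borel_measurable (omega a)"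
    by measurable
  have "norm (complex_of_real (bessel_entire a ((\<xi> * y)\<^sup>2)) * (cis (y\<^sup>2 / (4 * t)) * \<phi> y)) \<le> norm (bessel_coeff a 0 * cmod (\<phi> y))" for y
    using bessel_entire_bound[OF a, of "(\<xi> * y)\<^sup>2"] by (simp add: norm_mult abs_mult mult_right_mono)
  then show "AE y in omega a. norm (complex_of_real (bessel_entire a ((\<xi> * y)\<^sup>2)) * (cis (y\<^sup>2 / (4 * t)) * \<phi> y)) \<le> norm (bessel_coeff a 0 * cmod (\<phi> y))"
    by simp
qed

lemma schr_add:
  assumes "integrable (omega a) f" "integrable (omega a) g"
  shows "schr a t (\<lambda>y. f y + g y) x = schr a t f x + schr a t g x"
proof -
  let ?I = "\<lambda>\<phi> y. complex_of_real (bessel_entire a ((x / (2 * \<bar>t\<bar>) * y)\<^sup>2)) * (cis (y\<^sup>2 / (4 * t)) * \<phi> y)"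
  have "(\<integral>y. ?I (\<lambda>y. f y + g y) y \<partial>omega a) = (\<integral>y. ?I f y + ?I g y \<partial>omega a)"
    by (simp only: distrib_left)
  also have "\<dots> = (\<integral>y. ?I f y \<partial>omega a) + (\<integral>y. ?I g y \<partial>omega a)"
    by (intro Bochner_Integration.integral_add integrable_schr assms)
  finally show ?thesis unfolding schr_def by (simp only: distrib_left)
qed

lemma schr_measurable:
  assumes [measurable]: "(\<lambda>(y, \<tau>). \<phi> y \<tau>) \<in> borel_measurable (borel \<Otimes>\<^sub>M borel)"
  shows "(\<lambda>(x, \<tau>). schr a (t - \<tau>) (\<lambda>y. \<phi> y \<tau>) x) \<in> borel_measurable (borel \<Otimes>\<^sub>M borel)"
  unfolding schr_def schr_factor_def by measurable

lemma norm_schr_le: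
  assumes "integrable (omega a) \<phi>"
  shows "cmod (schr a t \<phi> x) \<le> (2 * \<bar>t\<bar>) powr (- ((a + 1) / 2)) * bessel_coeff a 0 * (\<integral>y. cmod (\<phi> y) \<partial>omega a)"
proof -
  have "cmod (\<integral>y. complex_of_real (bessel_entire a ((x / (2 * \<bar>t\<bar>) * y)\<^sup>2)) * (cis (y\<^sup>2 / (4 * t)) * \<phi> y) \<partial>omega a)
     \<le> (\<integral>y. bessel_coeff a 0 * cmod (\<phi> y) \<partial>omega a)"
  proof (rule order_trans[OF integral_norm_bound], rule integral_mono[OF integrable_norm[OF integrable_schr[OF assms]]])
    show "cmod (complex_of_real (bessel_entire a ((x / (2 * \<bar>t\<bar>) * y)\<^sup>2)) * (cis (y\<^sup>2 / (4 * t)) * \<phi> y)) \<le> bessel_coeff a 0 * cmod (\<phi> y)" for y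
      using bessel_entire_bound[OF a, of "(x / (2 * \<bar>t\<bar>) * y)\<^sup>2"] by (simp add: norm_mult mult_right_mono)
  qed (use assms in auto)
  then show ?thesis
    unfolding schr_def norm_mult norm_schr_factor by (simp add: mult.assoc mult_left_mono)
qed

text \<open>The chirps are unimodular, so the real and imaginary parts of the chirped data can be
  transformed separately. The squared amplitude c^(-(a+1)) with c = 2|t| cancels the Jacobian
  c^(a+1) of the dilation.\<close>

lemma schr_L2:
  assumes \<phi>: "integrable (omega a) \<phi>" "integrable (omega a) (\<lambda>y. (cmod (\<phi> y))\<^sup>2)" and t: "t \<noteq> 0"
  shows "(\<integral>\<^sup>+x. ennreal ((cmod (schr a t \<phi> x))\<^sup>2) \<partial>omega a) \<le> (\<integral>\<^sup>+y. ennreal ((cmod (\<phi> y))\<^sup>2) \<partial>omega a)"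
proof -
  have [measurable]: "\<phi> \<in> borel_measurable borel" using borel_measurable_integrable[OF \<phi>(1)] by simp
  define \<psi> where "\<psi> y = cis (y\<^sup>2 / (4 * t)) * \<phi> y" for y
  have [measurable]: "\<psi> \<in> borel_measurable borel" unfolding \<psi>_def by measurable
  have norm\<psi>: "cmod (\<psi> y) = cmod (\<phi> y)" for y by (simp add: \<psi>_def norm_mult)
  have \<psi>: "integrable (omega a) \<psi>"
    by (rule Bochner_Integration.integrable_bound[OF \<phi>(1)]) (auto simp: norm\<psi>)
  have sq: "(cmod z)\<^sup>2 = (Re z)\<^sup>2 + (Im z)\<^sup>2" for z by (rule cmod_power2)
  have re: "integrable (omega a) (\<lambda>y. (Re (\<psi> y))\<^sup>2)" and im: "integrable (omega a) (\<lambda>y. (Im (\<psi> y))\<^sup>2)"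
    by (rule Bochner_Integration.integrable_bound[OF \<phi>(2)]; auto simp: norm\<psi>[symmetric] sq)+
  define h1 where "h1 = hankel a (\<lambda>y. Re (\<psi> y))"
  define h2 where "h2 = hankel a (\<lambda>y. Im (\<psi> y))"
  have [measurable]: "h1 \<in> borel_measurable borel" "h2 \<in> borel_measurable borel"
    unfolding h1_def h2_def by (intro hankel_measurable[OF a]; measurable)+
  define c where "c = 2 * \<bar>t\<bar>"
  have c: "0 < c" using t by (simp add: c_def)
  have eq: "(cmod (schr a t \<phi> x))\<^sup>2 = c powr (- (a + 1)) * ((h1 (x / c))\<^sup>2 + (h2 (x / c))\<^sup>2)" for x
  proof -
    define I where "I = (\<integral>y. complex_of_real (bessel_entire a ((x / c * y)\<^sup>2)) * \<psi> y \<partial>omega a)"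
    have int: "integrable (omega a) (\<lambda>y. complex_of_real (bessel_entire a ((x / c * y)\<^sup>2)) * \<psi> y)"
      unfolding \<psi>_def by (rule integrable_schr[OF \<phi>(1)])
    have "Re I = h1 (x / c)" "Im I = h2 (x / c)"
      unfolding I_def h1_def h2_def hankel_def integral_Re[OF int, symmetric] integral_Im[OF int, symmetric]
      by simp_all
    then have "(cmod I)\<^sup>2 = (h1 (x / c))\<^sup>2 + (h2 (x / c))\<^sup>2" by (simp add: sq)
    moreover have "schr a t \<phi> x = schr_factor a t x * I" by (simp add: schr_def I_def \<psi>_def c_def)
    moreover have "((2 * \<bar>t\<bar>) powr (- ((a + 1) / 2)))\<^sup>2 = c powr (- (a + 1))"
      unfolding power2_eq_square powr_add[symmetric] c_def by (rule arg_cong[of _ _ "(powr) (2 * \<bar>t\<bar>)"]) (simp add: field_simps)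
    ultimately show ?thesis by (simp add: norm_mult power_mult_distrib norm_schr_factor)
  qed
  have "(\<integral>\<^sup>+x. ennreal ((cmod (schr a t \<phi> x))\<^sup>2) \<partial>omega a)
     = (\<integral>\<^sup>+x. ennreal (c powr (- (a + 1))) * (ennreal ((h1 (x / c))\<^sup>2) + ennreal ((h2 (x / c))\<^sup>2)) \<partial>omega a)"
    unfolding eq by (simp add: ennreal_mult ennreal_plus)
  also have "\<dots> = ennreal (c powr (- (a + 1))) * (\<integral>\<^sup>+x. ennreal ((h1 (x / c))\<^sup>2) + ennreal ((h2 (x / c))\<^sup>2) \<partial>omega a)"
    by (rule nn_integral_cmult) measurable
  also have "(\<integral>\<^sup>+x. ennreal ((h1 (x / c))\<^sup>2) + ennreal ((h2 (x / c))\<^sup>2) \<partial>omega a)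
     = ennreal (c powr (a + 1)) * (\<integral>\<^sup>+x. ennreal ((h1 x)\<^sup>2) + ennreal ((h2 x)\<^sup>2) \<partial>omega a)"
    by (rule nn_integral_omega_dilate[OF _ c]) measurable
  also have "ennreal (c powr (- (a + 1))) * \<dots> = ennreal 1 * (\<integral>\<^sup>+x. ennreal ((h1 x)\<^sup>2) + ennreal ((h2 x)\<^sup>2) \<partial>omega a)"
    by (rule ennreal_mult_assoc_eq) (use c in \<open>auto simp flip: powr_add\<close>)
  also have "\<dots> = (\<integral>\<^sup>+x. ennreal ((h1 x)\<^sup>2) \<partial>omega a) + (\<integral>\<^sup>+x. ennreal ((h2 x)\<^sup>2) \<partial>omega a)"
    by (simp add: nn_integral_add)
  also have "\<dots> \<le> (\<integral>\<^sup>+x. ennreal ((Re (\<psi> x))\<^sup>2) \<partial>omega a) + (\<integral>\<^sup>+x. ennreal ((Im (\<psi> x))\<^sup>2) \<partial>omega a)"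
    using hankel_contracts_L1_L2[OF a integrable_Re[OF \<psi>] re] hankel_contracts_L1_L2[OF a integrable_Im[OF \<psi>] im]
    unfolding hankel_contracts_def h1_def h2_def by (intro add_mono)
  also have "\<dots> = (\<integral>\<^sup>+x. ennreal ((Re (\<psi> x))\<^sup>2) + ennreal ((Im (\<psi> x))\<^sup>2) \<partial>omega a)"
    by (rule nn_integral_add[symmetric]) measurable
  also have "\<dots> = (\<integral>\<^sup>+y. ennreal ((cmod (\<phi> y))\<^sup>2) \<partial>omega a)"
    by (simp add: norm\<psi>[symmetric] sq ennreal_plus)
  finally show ?thesis .
qed

text \<open>Interpolation with A proportional to |t|^(-(a+1)/2) produces A^(r-2). The estimate stays
  at the level of r-th powers, the form in which Minkowski's inequality takes its
  hypothesis.\<close>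

lemma schr_dispersive:
  assumes \<phi>: "integrable (omega a) \<phi>" "integrable (omega a) (\<lambda>y. (cmod (\<phi> y))\<^sup>2)" and t: "t \<noteq> 0" and r: "2 < r"
  shows "(\<integral>\<^sup>+x. ennreal (cmod (schr a t \<phi> x) powr r) \<partial>omega a) \<le>
    ennreal (4 * r / (r - 2) * (2 * bessel_coeff a 0) powr (r - 2) * (2 * \<bar>t\<bar>) powr (- ((a + 1) / 2) * (r - 2)))
      * ennpow (\<integral>\<^sup>+y. ennreal (cmod (\<phi> y) powr (r / (r - 1))) \<partial>omega a) (r - 1)"
proof -
  define A where "A = (2 * \<bar>t\<bar>) powr (- ((a + 1) / 2)) * bessel_coeff a 0"
  have "0 < A" using t bessel_coeff_0_pos by (simp add: A_def)
  have "(\<integral>\<^sup>+x. ennreal (cmod (schr a t \<phi> x) powr r) \<partial>omega a) \<le>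
    ennreal (4 * r / (r - 2) * (2 * A) powr (r - 2)) * ennpow (\<integral>\<^sup>+y. ennreal (cmod (\<phi> y) powr (r / (r - 1))) \<partial>omega a) (r - 1)"
  proof (rule interpolation_L1_L2[OF sigma_finite_omega sigma_finite_omega])
    show "schr a t f \<in> borel_measurable (omega a)" if "integrable (omega a) f" for f
    proof -
      have [measurable]: "f \<in> borel_measurable borel" using borel_measurable_integrable[OF that] by simp
      show ?thesis unfolding schr_def schr_factor_def by measurable
    qed
    show "cmod (schr a t f x) \<le> A * (\<integral>y. cmod (f y) \<partial>omega a)" if "integrable (omega a) f" for f x
      unfolding A_def by (rule norm_schr_le[OF that])
  qed (use schr_add schr_L2 \<phi> t r \<open>0 < A\<close> in auto)
  also have "(2 * A) powr (r - 2) = (2 * bessel_coeff a 0) powr (r - 2) * (2 * \<bar>t\<bar>) powr (- ((a + 1) / 2) * (r - 2))"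
  proof -
    have "(2 * A) powr (r - 2) = (2 * bessel_coeff a 0 * (2 * \<bar>t\<bar>) powr (- ((a + 1) / 2))) powr (r - 2)"
      by (simp add: A_def mult_ac)
    then show ?thesis by (simp only: powr_mult powr_powr)
  qed
  finally show ?thesis by (simp only: mult.assoc)
qed

end

section \<open>Measurability and integrability of the test functions\<close>

definition cut_pos :: "(real \<Rightarrow> real \<Rightarrow> complex) \<Rightarrow> real \<Rightarrow> real \<Rightarrow> complex" where
  "cut_pos F y \<tau> = (if 0 < y then F y \<tau> else 0)"

lemma Splus_cut_measurable:
  assumes "F \<in> Splus"
  shows "(\<lambda>(y, \<tau>). cut_pos F y \<tau>) \<in> borel_measurable (borel \<Otimes>\<^sub>M borel)"
proof -
  have "smooth_pos F" using assms by (simp add: Splus_def)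
  then have "\<forall>w. continuous_on ({0<..} \<times> UNIV) (\<lambda>(x, t). dpart w F x t)"
    by (simp add: smooth_pos_def)
  \<comment> \<open>The empty word of derivatives is the function itself.\<close>
  then have "continuous_on ({0<..} \<times> UNIV) (\<lambda>(x, t). dpart [] F x t)" by blast
  then have cont: "continuous_on ({0<..} \<times> UNIV) (\<lambda>(x, t). F x t)" by simp
  have "{0<..} \<times> (UNIV :: real set) \<in> sets (borel :: (real \<times> real) measure)"
    by (intro borel_open open_Times) auto
  from borel_measurable_continuous_on_indicator[OF this cont]
  have "(\<lambda>p. indicator ({0<..} \<times> UNIV) p *\<^sub>R (case p of (x, t) \<Rightarrow> F x t)) \<in> borel_measurable (borel \<Otimes>\<^sub>M borel)"
    by (simp add: borel_prod)
  also have "(\<lambda>p. indicator ({0<..} \<times> UNIV) p *\<^sub>R (case p of (x, t) \<Rightarrow> F x t)) = (\<lambda>(y, \<tau>). cut_pos F y \<tau>)"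
    by (auto simp: fun_eq_iff cut_pos_def indicator_def)
  finally show ?thesis .
qed

text \<open>The seminorm without derivatives suffices: F is bounded near y = 0 and y^a |F| is
  O(y^(-2)) at infinity. Square integrability follows because F is bounded.\<close>

lemma Splus_cut_integrable:
  assumes F: "F \<in> Splus" and a: "0 \<le> a"
  shows "integrable (omega a) (\<lambda>y. cut_pos F y \<tau>)" "integrable (omega a) (\<lambda>y. (cmod (cut_pos F y \<tau>))\<^sup>2)"
proof -
  note Splus_cut_measurable[OF F, measurable]
  \<comment> \<open>The order p absorbs the weight y^a and leaves two powers of y for the
    tail.\<close>
  obtain p :: nat where p: "a + 2 \<le> real p" using real_arch_simple by blast
  have "\<forall>p::nat. \<exists>M. \<forall>k l. k + l \<le> p \<longrightarrow> (\<forall>x>0. \<forall>t.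
      (1 + x\<^sup>2 + t\<^sup>2) powr (real p / 2) * cmod ((Lx ^^ k) ((pdert ^^ l) F) x t) \<le> M)"
    using F by (simp add: Splus_def)
  then obtain M where "\<forall>k l. k + l \<le> p \<longrightarrow> (\<forall>x>0. \<forall>t.
      (1 + x\<^sup>2 + t\<^sup>2) powr (real p / 2) * cmod ((Lx ^^ k) ((pdert ^^ l) F) x t) \<le> M)" by blast
  from this[rule_format, of 0 0]
  have M: "(1 + x\<^sup>2 + t\<^sup>2) powr (real p / 2) * cmod (F x t) \<le> M" if "0 < x" for x t
    using that by simp
  have w1: "1 \<le> (1 + x\<^sup>2 + t\<^sup>2) powr (real p / 2)" for x t :: real
    by (rule ge_one_powr_ge_zero) auto
  have M0: "0 \<le> M" using M[of 1 0] by (rule order_trans[rotated]) auto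
  have bd: "cmod (cut_pos F y \<tau>) \<le> M" for y
  proof (cases "0 < y")
    case True
    have "1 * cmod (F y \<tau>) \<le> (1 + y\<^sup>2 + \<tau>\<^sup>2) powr (real p / 2) * cmod (F y \<tau>)"
      by (rule mult_right_mono[OF w1]) simp
    then show ?thesis using M[OF True, of \<tau>] True by (simp add: cut_pos_def)
  qed (use M0 in \<open>simp add: cut_pos_def\<close>)
  have dom: "ennreal (indicator {0<..} y * y powr a) * ennreal (cmod (cut_pos F y \<tau>))
     \<le> ennreal M * (indicator {0..1} y + ennreal (\<bar>y\<bar> powr (- 2)) * indicator {s. 1 < \<bar>s\<bar>} y)" for y
  proof -
    consider "y \<le> 0" | "0 < y" "y \<le> 1" | "1 < y" by linarith
    then show ?thesis
    proof cases
      case 2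
      then have "y powr a * cmod (cut_pos F y \<tau>) \<le> 1 * M"
        using a bd[of y] by (intro mult_mono powr_le1) auto
      then show ?thesis using 2 by (simp add: ennreal_leI flip: ennreal_mult)
    next
      case 3
      have "y powr a * y powr 2 \<le> y powr real p"
        unfolding powr_add[symmetric] using 3 p by (intro powr_mono) auto
      also have "\<dots> = (y powr 2) powr (real p / 2)" by (simp add: powr_powr)
      also have "\<dots> \<le> (1 + y\<^sup>2 + \<tau>\<^sup>2) powr (real p / 2)"
        using 3 by (intro powr_mono2) auto
      finally have "y powr a * y powr 2 * cmod (F y \<tau>) \<le> (1 + y\<^sup>2 + \<tau>\<^sup>2) powr (real p / 2) * cmod (F y \<tau>)"
        by (rule mult_right_mono) simp
      also have "\<dots> \<le> M" using 3 by (intro M) auto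
      finally have "y powr a * cmod (F y \<tau>) \<le> M * y powr (- 2)"
        using 3 by (simp add: powr_minus field_simps)
      then show ?thesis using 3 M0
        by (simp add: cut_pos_def ennreal_leI flip: ennreal_mult)
    qed (simp add: cut_pos_def)
  qed
  have "(\<integral>\<^sup>+y. ennreal (cmod (cut_pos F y \<tau>)) \<partial>omega a)
     = (\<integral>\<^sup>+y. ennreal (indicator {0<..} y * y powr a) * ennreal (cmod (cut_pos F y \<tau>)) \<partial>lborel)"
    by (rule nn_integral_omega) measurable
  also have "\<dots> \<le> (\<integral>\<^sup>+y. ennreal M * (indicator {0..1} y + ennreal (\<bar>y\<bar> powr (- 2)) * indicator {s. 1 < \<bar>s\<bar>} y) \<partial>lborel)"
    by (rule nn_integral_mono) (rule dom)
  also have "\<dots> = ennreal M * (1 + (\<integral>\<^sup>+y. ennreal (\<bar>y\<bar> powr (- 2)) * indicator {s. 1 < \<bar>s\<bar>} y \<partial>lborel))"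
    by (simp add: nn_integral_cmult nn_integral_add)
  also have "\<dots> \<le> ennreal M * (1 + ennreal (2 / 1))"
    by (intro mult_left_mono add_left_mono nn_integral_abs_powr_tail) auto
  also have "\<dots> < \<infinity>" by (simp add: ennreal_mult_less_top)
  finally show 1: "integrable (omega a) (\<lambda>y. cut_pos F y \<tau>)"
    by (intro integrableI_bounded) auto
  show "integrable (omega a) (\<lambda>y. (cmod (cut_pos F y \<tau>))\<^sup>2)"
  proof (rule Bochner_Integration.integrable_bound)
    show "integrable (omega a) (\<lambda>y. M * cmod (cut_pos F y \<tau>))" using 1 by simp
    show "AE y in omega a. norm ((cmod (cut_pos F y \<tau>))\<^sup>2) \<le> norm (M * cmod (cut_pos F y \<tau>))"
      using bd M0 by (auto simp: power2_eq_square abs_mult intro!: mult_right_mono)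
  qed measurable
qed

lemma Lr_a_norm_cut:
  assumes [measurable]: "(\<lambda>y. cut_pos F y \<tau>) \<in> borel_measurable borel"
  shows "Lr_a_norm a p (\<lambda>y. F y \<tau>) = ennpow (\<integral>\<^sup>+y. ennreal (cmod (cut_pos F y \<tau>) powr p) \<partial>omega a) (1 / p)"
proof -
  have "(\<integral>\<^sup>+y. ennreal (cmod (cut_pos F y \<tau>) powr p) \<partial>omega a)
    = (\<integral>\<^sup>+y. ennreal (indicator {0<..} y * y powr a) * ennreal (cmod (cut_pos F y \<tau>) powr p) \<partial>lborel)"
    by (rule nn_integral_omega) measurable
  also have "\<dots> = (\<integral>\<^sup>+y\<in>{0<..}. ennreal (cmod (F y \<tau>) powr p * y powr a) \<partial>lborel)"
    by (rule nn_integral_cong) (auto simp: indicator_def cut_pos_def mult.commute simp flip: ennreal_mult)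
  finally show ?thesis by (simp add: Lr_a_norm_def)
qed

text \<open>A Bochner integral that does not exist has value 0, so the bound is unconditional and
  applies to the Duhamel integral as it stands.\<close>

lemma norm_integral_le_nn_integral:
  fixes f :: "'a \<Rightarrow> 'b :: {banach, second_countable_topology}"
  shows "ennreal (norm (integral\<^sup>L M f)) \<le> (\<integral>\<^sup>+x. ennreal (norm (f x)) \<partial>M)"
  by (cases "integrable M f") (auto simp: integral_norm_bound_ennreal not_integrable_integral_eq)

section \<open>Combining decay, Minkowski and Hardy-Littlewood-Sobolev\<close>

theorem theoremT:
  fixes a q r :: real
  assumes "a \<ge> 0" and "admissible a q r"
  shows "\<exists>C>0. \<forall>F\<in>Splus.
     mixed_norm a q r (duhamel a F) \<le> ennreal C * mixed_norm a (conj_exp q) (conj_exp r) F"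
proof -
  note a = assms(1)
  have r: "2 < r" and r': "a > 1 \<Longrightarrow> r < 2 * (a + 1) / (a - 1)" and q_eq: "2 / q = (a + 1) * (1 / 2 - 1 / r)"
    using assms(2) by (auto simp: admissible_def)
  \<comment> \<open>Strict positivity excludes q = 0 as well, because 2/0 is 0.\<close>
  have q0: "0 < 2 / q" unfolding q_eq using a r by (intro mult_pos_pos) (auto simp: field_simps)
  \<comment> \<open>For a > 1 this is a rearrangement of the upper limit on r; for a <= 1 it holds
    because a + 1 <= 2 and 1/2 - 1/r < 1/2.\<close>
  have "2 / q < 1"
  proof (cases "a > 1")
    case True
    then have "r * (a - 1) < 2 * (a + 1)" using r'[OF True] by (simp add: field_simps)
    then show ?thesis unfolding q_eq using r by (simp add: field_simps)
  next
    case False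
    then have "(a + 1) * (1 / 2 - 1 / r) \<le> 2 * (1 / 2 - 1 / r)" using r by (intro mult_right_mono) (auto simp: field_simps)
    also have "\<dots> < 1" using r by simp
    finally show ?thesis unfolding q_eq .
  qed
  then have q: "2 < q" using q0 by (simp add: field_simps zero_less_divide_iff)
  obtain C where C: "0 < C" and HLS: "\<And>g :: real \<Rightarrow> real. g \<in> borel_measurable borel \<Longrightarrow> (\<And>\<tau>. 0 \<le> g \<tau>) \<Longrightarrow>
      (\<integral>\<^sup>+t. ennpow (\<integral>\<^sup>+\<tau>. ennreal (\<bar>t - \<tau>\<bar> powr (- 2 / q)) * ennreal (g \<tau>) \<partial>lborel) q \<partial>lborel)
        \<le> ennreal C * ennpow (\<integral>\<^sup>+\<tau>. ennreal (g \<tau> powr (q / (q - 1))) \<partial>lborel) (q - 1)"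
    using Hardy_Littlewood_Sobolev_line[OF q] by blast
  \<comment> \<open>The dispersive constant together with the power of 2 taken out of 2|t|; its r-th
    root K gives the bound K |t|^(-2/q) from L^(r') to L^r.\<close>
  define c0 where "c0 = 4 * r / (r - 2) * (2 * bessel_coeff a 0) powr (r - 2) * 2 powr (- ((a + 1) / 2) * (r - 2))"
  have c0: "0 < c0" using r bessel_coeff_0_pos[OF a] by (simp add: c0_def)
  define K where "K = c0 powr (1 / r)"
  have K: "0 < K" using c0 by (simp add: K_def)
  have p: "conj_exp r = r / (r - 1)" "1 / conj_exp r = (r - 1) / r" "1 \<le> conj_exp r" "conj_exp r \<le> 2"
    using r by (auto simp: conj_exp_def field_simps)
  have "mixed_norm a q r (duhamel a F) \<le> ennreal (K * C powr (1 / q)) * mixed_norm a (conj_exp q) (conj_exp r) F"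
    if F: "F \<in> Splus" for F
  proof -
    note Splus_cut_measurable[OF F, measurable]
    note int = Splus_cut_integrable[OF F a]
    define N where "N \<tau> = (\<integral>\<^sup>+y. ennreal (cmod (cut_pos F y \<tau>) powr conj_exp r) \<partial>omega a)" for \<tau>
    have [measurable]: "N \<in> borel_measurable borel" unfolding N_def by measurable
    \<comment> \<open>The conjugate exponent lies between 1 and 2, so integrability of the slice and
      of its square suffices. Finiteness makes the slice norm a real function, as Minkowski and
      Hardy-Littlewood-Sobolev require.\<close>
    have Nfin: "N \<tau> < top" for \<tau>
    proof -
      have "N \<tau> \<le> (\<integral>\<^sup>+y. ennreal (cmod (cut_pos F y \<tau>) + (cmod (cut_pos F y \<tau>))\<^sup>2) \<partial>omega a)"
        unfolding N_def by (intro nn_integral_mono ennreal_leI powr_le_add_square p) auto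
      also have "\<dots> = ennreal (\<integral>y. cmod (cut_pos F y \<tau>) + (cmod (cut_pos F y \<tau>))\<^sup>2 \<partial>omega a)"
        using int[of \<tau>] by (intro nn_integral_eq_integral) auto
      finally show ?thesis by (rule le_less_trans) simp
    qed
    \<comment> \<open>The spatial L^(r') norm of the slice, since (r-1)/r = 1/r'.\<close>
    define g where "g \<tau> = enn2real (ennpow (N \<tau>) ((r - 1) / r))" for \<tau>
    have [measurable]: "g \<in> borel_measurable borel" unfolding g_def by measurable
    have g0: "0 \<le> g \<tau>" for \<tau> by (simp add: g_def)
    have gN: "ennreal (g \<tau>) = ennpow (N \<tau>) ((r - 1) / r)" for \<tau>
      using Nfin[of \<tau>] by (cases "N \<tau>") (auto simp: g_def ennpow_ennreal)
    have gr: "ennreal (g \<tau> powr r) = ennpow (N \<tau>) (r - 1)" for \<tau>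
    proof -
      have "ennreal (g \<tau> powr r) = ennpow (ennreal (g \<tau>)) r" by (simp add: ennpow_ennreal g0)
      then show ?thesis using r by (simp add: gN ennpow_ennpow)
    qed
    define W where "W t = (\<integral>\<^sup>+\<tau>. ennreal (K * \<bar>t - \<tau>\<bar> powr (- 2 / q) * g \<tau>) \<partial>lborel)" for t
    have WHLS: "W t = ennreal K * (\<integral>\<^sup>+\<tau>. ennreal (\<bar>t - \<tau>\<bar> powr (- 2 / q)) * ennreal (g \<tau>) \<partial>lborel)" for t
      unfolding W_def using K g0 by (subst nn_integral_cmult[symmetric]) (auto simp: ennreal_mult mult.assoc)
    have space: "Lr_a_norm a r (\<lambda>x. duhamel a F x t) \<le> W t" for t
    proof -
      define H where "H x \<tau> = cmod (schr a (t - \<tau>) (\<lambda>y. cut_pos F y \<tau>) x)" for x \<tau>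
      have H[measurable]: "(\<lambda>(x, \<tau>). H x \<tau>) \<in> borel_measurable (borel \<Otimes>\<^sub>M borel)"
        using schr_measurable[OF a Splus_cut_measurable[OF F], of t] unfolding H_def by measurable
      have mink: "(\<integral>\<^sup>+x. ennpow (\<integral>\<^sup>+\<tau>. ennreal (H x \<tau>) \<partial>lborel) r \<partial>omega a) \<le> ennpow (W t) r"
        unfolding W_def
      proof (rule nn_integral_ennpow_Minkowski[OF sigma_finite_omega sigma_finite_lborel])
        show "(\<lambda>(x, \<tau>). H x \<tau>) \<in> borel_measurable (omega a \<Otimes>\<^sub>M lborel)" by measurable
        show "AE \<tau> in lborel. (\<integral>\<^sup>+x. ennreal (H x \<tau> powr r) \<partial>omega a) \<le> ennreal ((K * \<bar>t - \<tau>\<bar> powr (- 2 / q) * g \<tau>) powr r)"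
          using AE_lborel_singleton[of t]
        proof eventually_elim
          case (elim \<tau>)
          then have s: "t - \<tau> \<noteq> 0" by simp
          have "(\<integral>\<^sup>+x. ennreal (H x \<tau> powr r) \<partial>omega a) \<le>
            ennreal (4 * r / (r - 2) * (2 * bessel_coeff a 0) powr (r - 2) * (2 * \<bar>t - \<tau>\<bar>) powr (- ((a + 1) / 2) * (r - 2)))
            * ennpow (N \<tau>) (r - 1)"
            using schr_dispersive[OF a int s r] by (simp add: H_def N_def p)
          also have "4 * r / (r - 2) * (2 * bessel_coeff a 0) powr (r - 2) * (2 * \<bar>t - \<tau>\<bar>) powr (- ((a + 1) / 2) * (r - 2))
            = (K * \<bar>t - \<tau>\<bar> powr (- 2 / q)) powr r"
          proof -
            \<comment> \<open>Admissibility turns the dispersive exponent into the exponent of the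
              fractional kernel.\<close>
            have "- ((a + 1) / 2) * (r - 2) = (- 2 / q) * r"
            proof -
              have "(2 / q) * r = (a + 1) / 2 * (r - 2)" unfolding q_eq using r by (simp add: field_simps)
              then show ?thesis by simp
            qed
            moreover have "K powr r = c0" using c0 r by (simp add: K_def powr_powr)
            ultimately show ?thesis by (simp add: c0_def powr_mult powr_powr)
          qed
          also have "ennreal ((K * \<bar>t - \<tau>\<bar> powr (- 2 / q)) powr r) * ennpow (N \<tau>) (r - 1)
            = ennreal ((K * \<bar>t - \<tau>\<bar> powr (- 2 / q) * g \<tau>) powr r)"
            unfolding gr[symmetric] by (simp only: powr_mult) (simp add: ennreal_mult)
          finally show ?case .
        qed
      qed (use r K g0 in \<open>auto simp: H_def\<close>)
      have pt: "ennreal (cmod (duhamel a F x t)) \<le> (\<integral>\<^sup>+\<tau>. ennreal (H x \<tau>) \<partial>lborel)" if x: "0 < x" for x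
      proof -
        have "ennreal (cmod (duhamel a F x t)) \<le> (\<integral>\<^sup>+\<tau>. ennreal (cmod (Sop a (t - \<tau>) (\<lambda>y. F y \<tau>) x)) \<partial>lborel)"
          unfolding duhamel_def by (rule norm_integral_le_nn_integral)
        also have "\<dots> = (\<integral>\<^sup>+\<tau>. ennreal (H x \<tau>) \<partial>lborel)"
        \<comment> \<open>At \<tau> = t, \<open>Sop\<close> is the identity whereas
          \<open>schr\<close> vanishes; this single time is a null set.\<close>
        proof (rule nn_integral_cong_AE, use AE_lborel_singleton[of t] in eventually_elim)
          fix \<tau> assume "\<tau> \<noteq> t"
          then have s: "t - \<tau> \<noteq> 0" by simp
          have "(\<lambda>y. cut_pos F y \<tau>) \<in> borel_measurable borel" by measurable
          then show "ennreal (cmod (Sop a (t - \<tau>) (\<lambda>y. F y \<tau>) x)) = ennreal (H x \<tau>)"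
            using Sop_eq_schr[OF a, of "\<lambda>y. F y \<tau>" "t - \<tau>" x] s x by (simp add: H_def cut_pos_def)
        qed
        finally show ?thesis .
      qed
      have "(\<integral>\<^sup>+x\<in>{0<..}. ennreal (cmod (duhamel a F x t) powr r * x powr a) \<partial>lborel)
        \<le> (\<integral>\<^sup>+x. ennreal (indicator {0<..} x * x powr a) * ennpow (\<integral>\<^sup>+\<tau>. ennreal (H x \<tau>) \<partial>lborel) r \<partial>lborel)"
      proof (rule nn_integral_mono)
        fix x :: real
        show "ennreal (cmod (duhamel a F x t) powr r * x powr a) * indicator {0<..} x
          \<le> ennreal (indicator {0<..} x * x powr a) * ennpow (\<integral>\<^sup>+\<tau>. ennreal (H x \<tau>) \<partial>lborel) r"
        proof (cases "0 < x")
          case True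
          have "ennreal (cmod (duhamel a F x t) powr r) \<le> ennpow (\<integral>\<^sup>+\<tau>. ennreal (H x \<tau>) \<partial>lborel) r"
            using ennpow_mono[OF _ pt[OF True], of r] r by (simp add: ennpow_ennreal)
          from mult_left_mono[OF this, of "ennreal (x powr a)"] show ?thesis
            using True by (simp add: ennreal_mult mult.commute)
        qed simp
      qed
      also have "\<dots> = (\<integral>\<^sup>+x. ennpow (\<integral>\<^sup>+\<tau>. ennreal (H x \<tau>) \<partial>lborel) r \<partial>omega a)"
        by (rule nn_integral_omega[symmetric]) measurable
      also note mink
      finally have "Lr_a_norm a r (\<lambda>x. duhamel a F x t) \<le> ennpow (ennpow (W t) r) (1 / r)"
        unfolding Lr_a_norm_def using r by (intro ennpow_mono) auto
      then show ?thesis using r by (simp add: ennpow_ennpow)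
    qed
    define G where "G = (\<integral>\<^sup>+\<tau>. ennreal (g \<tau> powr (q / (q - 1))) \<partial>lborel)"
    have "Lr_a_norm a (conj_exp r) (\<lambda>y. F y \<tau>) = ennreal (g \<tau>)" for \<tau>
      by (subst Lr_a_norm_cut) (simp_all add: gN N_def p)
    then have rhs: "mixed_norm a (conj_exp q) (conj_exp r) F = ennpow G ((q - 1) / q)"
      using q by (simp add: mixed_norm_def G_def ennpow_ennreal g0 conj_exp_def)
    have "(\<integral>\<^sup>+t. ennpow (Lr_a_norm a r (\<lambda>x. duhamel a F x t)) q \<partial>lborel) \<le> (\<integral>\<^sup>+t. ennpow (W t) q \<partial>lborel)"
      using q by (intro nn_integral_mono ennpow_mono space) auto
    also have "\<dots> = ennreal (K powr q) * (\<integral>\<^sup>+t. ennpow (\<integral>\<^sup>+\<tau>. ennreal (\<bar>t - \<tau>\<bar> powr (- 2 / q)) * ennreal (g \<tau>) \<partial>lborel) q \<partial>lborel)"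
      unfolding WHLS ennpow_cmult[OF K] by (rule nn_integral_cmult) measurable
    also have "\<dots> \<le> ennreal (K powr q) * (ennreal C * ennpow G (q - 1))"
      unfolding G_def by (intro mult_left_mono HLS g0) auto
    also have "\<dots> = ennreal (K powr q * C) * ennpow G (q - 1)"
      by (rule ennreal_mult_assoc_eq) (use C in auto)
    finally have "mixed_norm a q r (duhamel a F) \<le> ennpow (ennreal (K powr q * C) * ennpow G (q - 1)) (1 / q)"
      unfolding mixed_norm_def using q by (intro ennpow_mono) auto
    also have "\<dots> = ennreal ((K powr q * C) powr (1 / q)) * ennpow G ((q - 1) / q)"
      using K C by (simp add: ennpow_cmult ennpow_ennpow)
    also have "(K powr q * C) powr (1 / q) = K * C powr (1 / q)"
      using K C q by (simp add: powr_mult powr_powr)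
    finally show ?thesis unfolding rhs .
  qed
  moreover have "0 < K * C powr (1 / q)" using K C by simp
  ultimately show ?thesis by blast
qed

end
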